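(* Let $1\le p<\infty$ or $p=0$, and let $\mathcal{X}$ be a Banach space with $\mathcal{X}\simeq\left(\bigoplus_{i=0}^{\infty}\mathcal{X}\right)_p$. In the case $p=1$ assume in addition that $\mathcal{X}=L_1$ or $\mathcal{X}=\ell_1$. Let $T\in\mathcal{L}(\mathcal{X})$ and suppose that $P$ is a bounded linear projection on $\mathcal{X}$ such that $P\mathcal{X}\simeq\mathcal{X}\simeq(I-P)\mathcal{X}$ and such that either $TP$ or $PT$ is a compact operator. Then $T$ is a commutator.
   Context: $\simeq$ means "is isomorphic to" (linearly homeomorphic), $L_1=L_1[0,1]$, and $\mathcal{L}(\mathcal{X})$ is the algebra of bounded linear operators on $\mathcal{X}$. For $1\le p<\infty$, $\left(\bigoplus_{i=0}^\infty \mathcal{X}\right)_p$ is the space of sequences $f=(f_i)$, $f_i\in \mathcal{X}$, with $\|f\|^p=\sum_i\|f_i\|^p<\infty$; for $p=0$ it is the space of sequences with $\|f_i\|\to 0$ and norm $\|f\|=\sup_i\|f_i\|$. An operator $T$ is a commutator if $T=AB-BA$ for some $A,B\in\mathcal{L}(\mathcal{X})$. *)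

theory Defs
  imports "HOL-Analysis.Analysis" "HOL-Library.Function_Algebras"
begin

section \<open>Scalars\<close>

text \<open>
  The scalar field is a type of sort \<open>{real_normed_field, euclidean_space}\<close>. Both
  \<^typ>\<open>real\<close> and \<^typ>\<open>complex\<close> are instances and, by the Gelfand--Mazur theorem, up to
  isometric isomorphism there are no others. A Banach space over \<open>'k\<close> is a type of class
  \<^class>\<open>banach\<close> together with a multiplication by scalars from \<open>'k\<close>
  that extends the real one and is compatible with the norm.
\<close>

definition normed_scaling ::
    "('k::{real_normed_field, euclidean_space} \<Rightarrow> 'a::real_normed_vector \<Rightarrow> 'a) \<Rightarrow> bool" where
  "normed_scaling s \<longleftrightarrow> vector_space s \<and>
     (\<forall>c x. norm (s c x) = norm c * norm x) \<and> (\<forall>r x. s (of_real r) x = r *\<^sub>R x)"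


section \<open>Operators\<close>

definition bounded_operator ::
    "('k::{real_normed_field, euclidean_space} \<Rightarrow> 'a::real_normed_vector \<Rightarrow> 'a) \<Rightarrow> ('a \<Rightarrow> 'a) \<Rightarrow> bool" where
  "bounded_operator s T \<longleftrightarrow> Vector_Spaces.linear s s T \<and> bounded_linear T"

definition compact_operator ::
    "('k::{real_normed_field, euclidean_space} \<Rightarrow> 'a::real_normed_vector \<Rightarrow> 'a) \<Rightarrow> ('a \<Rightarrow> 'a) \<Rightarrow> bool" where
  "compact_operator s T \<longleftrightarrow> bounded_operator s T \<and> compact (closure (T ` cball 0 1))"

definition bounded_projection ::
    "('k::{real_normed_field, euclidean_space} \<Rightarrow> 'a::real_normed_vector \<Rightarrow> 'a) \<Rightarrow> ('a \<Rightarrow> 'a) \<Rightarrow> bool" where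
  "bounded_projection s P \<longleftrightarrow> bounded_operator s P \<and> P \<circ> P = P"

definition commutator ::
    "('k::{real_normed_field, euclidean_space} \<Rightarrow> 'a::real_normed_vector \<Rightarrow> 'a) \<Rightarrow> ('a \<Rightarrow> 'a) \<Rightarrow> bool" where
  "commutator s T \<longleftrightarrow>
     (\<exists>A B. bounded_operator s A \<and> bounded_operator s B \<and> T = (\<lambda>x. A (B x) - B (A x)))"


section \<open>Isomorphisms\<close>

text \<open>
  Subspaces and sequence spaces are not types, so a normed space is given by a scalar
  multiplication \<open>s\<close>, a carrier \<open>S\<close> and a norm \<open>N\<close> on \<open>S\<close>; addition is that of the
  ambient type (pointwise for sequences).
\<close>

definition linear_bijection ::
    "('k \<Rightarrow> 'b::ab_group_add \<Rightarrow> 'b) \<Rightarrow> 'b set \<Rightarrow> ('k \<Rightarrow> 'c::ab_group_add \<Rightarrow> 'c) \<Rightarrow> 'c set \<Rightarrow> ('b \<Rightarrow> 'c) \<Rightarrow> bool" where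
  "linear_bijection s S s' S' J \<longleftrightarrow> bij_betw J S S' \<and>
     (\<forall>x\<in>S. \<forall>y\<in>S. J (x + y) = J x + J y) \<and> (\<forall>c. \<forall>x\<in>S. J (s c x) = s' c (J x))"

text \<open>The two inequalities say that \<open>J\<close> and its inverse are bounded.\<close>

definition linearly_homeomorphic ::
    "('k \<Rightarrow> 'b::ab_group_add \<Rightarrow> 'b) \<Rightarrow> 'b set \<Rightarrow> ('b \<Rightarrow> real)
     \<Rightarrow> ('k \<Rightarrow> 'c::ab_group_add \<Rightarrow> 'c) \<Rightarrow> 'c set \<Rightarrow> ('c \<Rightarrow> real) \<Rightarrow> bool" where
  "linearly_homeomorphic s S N s' S' N' \<longleftrightarrow>
     (\<exists>J C. linear_bijection s S s' S' J \<and> (\<forall>x\<in>S. N' (J x) \<le> C * N x \<and> N x \<le> C * N' (J x)))"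

definition isometrically_isomorphic ::
    "('k \<Rightarrow> 'b::ab_group_add \<Rightarrow> 'b) \<Rightarrow> 'b set \<Rightarrow> ('b \<Rightarrow> real)
     \<Rightarrow> ('k \<Rightarrow> 'c::ab_group_add \<Rightarrow> 'c) \<Rightarrow> 'c set \<Rightarrow> ('c \<Rightarrow> real) \<Rightarrow> bool" where
  "isometrically_isomorphic s S N s' S' N' \<longleftrightarrow>
     (\<exists>J. linear_bijection s S s' S' J \<and> (\<forall>x\<in>S. N' (J x) = N x))"


section \<open>Infinite direct sums\<close>

text \<open>\<open>p = 0\<close> encodes the \<open>c\<^sub>0\<close>-sum; otherwise \<open>p \<ge> 1\<close> is intended.\<close>

definition seq_sum :: "real \<Rightarrow> (nat \<Rightarrow> 'a::real_normed_vector) set" where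
  "seq_sum p = (if p = 0 then {f. (\<lambda>i. norm (f i)) \<longlonglongrightarrow> 0}
                else {f. summable (\<lambda>i. norm (f i) powr p)})"

definition seq_norm :: "real \<Rightarrow> (nat \<Rightarrow> 'a::real_normed_vector) \<Rightarrow> real" where
  "seq_norm p f = (if p = 0 then (SUP i. norm (f i))
                   else (\<Sum>i. norm (f i) powr p) powr (1 / p))"

definition seq_scale :: "('k \<Rightarrow> 'a \<Rightarrow> 'a) \<Rightarrow> 'k \<Rightarrow> (nat \<Rightarrow> 'a) \<Rightarrow> (nat \<Rightarrow> 'a)" where
  "seq_scale s c f = (\<lambda>i. s c (f i))"


section \<open>The space $L_1[0,1]$\<close>

abbreviation unit_measure :: "real measure" where
  "unit_measure \<equiv> lebesgue_on {0..1}"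

definition L1_eq :: "(real \<Rightarrow> 'k::{real_normed_field, euclidean_space}) \<Rightarrow> (real \<Rightarrow> 'k) \<Rightarrow> bool" where
  "L1_eq f g \<longleftrightarrow> integrable unit_measure f \<and> integrable unit_measure g \<and> (AE x in unit_measure. f x = g x)"

quotient_type (overloaded) 'k L1 =
  "real \<Rightarrow> 'k::{real_normed_field, euclidean_space}" / partial: L1_eq
proof (rule part_equivpI)
  show "\<exists>f::real \<Rightarrow> 'k. L1_eq f f"
    by (rule exI[of _ "\<lambda>_. 0"]) (simp add: L1_eq_def)
  show "symp (L1_eq :: (real \<Rightarrow> 'k) \<Rightarrow> _)"
    by (rule sympI) (auto simp: L1_eq_def elim: AE_mp)
  show "transp (L1_eq :: (real \<Rightarrow> 'k) \<Rightarrow> _)"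
    by (rule transpI) (auto simp: L1_eq_def)
qed

lift_definition L1_scale :: "'k::{real_normed_field, euclidean_space} \<Rightarrow> 'k L1 \<Rightarrow> 'k L1" is
  "\<lambda>c f x. c * f x"
  by (auto simp: L1_eq_def)

instantiation L1 :: ("{real_normed_field, euclidean_space}") real_normed_vector
begin

lift_definition zero_L1 :: "'a L1" is "\<lambda>_. 0"
  by (simp add: L1_eq_def)

lift_definition plus_L1 :: "'a L1 \<Rightarrow> 'a L1 \<Rightarrow> 'a L1" is "\<lambda>f g x. f x + g x"
  by (auto simp: L1_eq_def)

lift_definition uminus_L1 :: "'a L1 \<Rightarrow> 'a L1" is "\<lambda>f x. - f x"
  by (auto simp: L1_eq_def)

lift_definition minus_L1 :: "'a L1 \<Rightarrow> 'a L1 \<Rightarrow> 'a L1" is "\<lambda>f g x. f x - g x"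
  by (auto simp: L1_eq_def)

lift_definition scaleR_L1 :: "real \<Rightarrow> 'a L1 \<Rightarrow> 'a L1" is "\<lambda>r f x. r *\<^sub>R f x"
  by (auto simp: L1_eq_def)

lift_definition norm_L1 :: "'a L1 \<Rightarrow> real" is "\<lambda>f. \<integral>x. norm (f x) \<partial>unit_measure"
  by (auto simp: L1_eq_def intro!: integral_cong_AE)

definition sgn_L1 :: "'a L1 \<Rightarrow> 'a L1" where
  "sgn_L1 f = inverse (norm f) *\<^sub>R f"

definition dist_L1 :: "'a L1 \<Rightarrow> 'a L1 \<Rightarrow> real" where
  "dist_L1 f g = norm (f - g)"

definition uniformity_L1 :: "('a L1 \<times> 'a L1) filter" where
  "uniformity_L1 = (INF e\<in>{0<..}. principal {(f, g). dist f g < e})"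

definition open_L1 :: "'a L1 set \<Rightarrow> bool" where
  "open_L1 U \<longleftrightarrow> (\<forall>f\<in>U. eventually (\<lambda>(f', g). f' = f \<longrightarrow> g \<in> U) uniformity)"

instance
proof
  fix f g h :: "'a L1" and a b :: real and U :: "'a L1 set"
  show "f + g + h = f + (g + h)"
    by transfer (auto simp: L1_eq_def algebra_simps)
  show "f + g = g + f"
    by transfer (auto simp: L1_eq_def algebra_simps)
  show "0 + f = f"
    by transfer (auto simp: L1_eq_def)
  show "- f + f = 0"
    by transfer (auto simp: L1_eq_def)
  show "f - g = f + - g"
    by transfer (auto simp: L1_eq_def)
  show "a *\<^sub>R (f + g) = a *\<^sub>R f + a *\<^sub>R g"
    by transfer (auto simp: L1_eq_def algebra_simps)
  show "(a + b) *\<^sub>R f = a *\<^sub>R f + b *\<^sub>R f"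
    by transfer (auto simp: L1_eq_def algebra_simps)
  show "a *\<^sub>R b *\<^sub>R f = (a * b) *\<^sub>R f"
    by transfer (auto simp: L1_eq_def)
  show "1 *\<^sub>R f = f"
    by transfer (auto simp: L1_eq_def)
  show "(norm f = 0) = (f = 0)"
    by transfer (auto simp: L1_eq_def integral_nonneg_eq_0_iff_AE)
  show "norm (f + g) \<le> norm f + norm g"
  proof transfer
    fix f g :: "real \<Rightarrow> 'a"
    assume "L1_eq f f" "L1_eq g g"
    then have fg: "integrable unit_measure f" "integrable unit_measure g"
      by (auto simp: L1_eq_def)
    then have "(\<integral>x. norm (f x + g x) \<partial>unit_measure) \<le> (\<integral>x. norm (f x) + norm (g x) \<partial>unit_measure)"
      by (intro integral_mono) (auto intro: norm_triangle_ineq)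
    then show "(\<integral>x. norm (f x + g x) \<partial>unit_measure)
        \<le> (\<integral>x. norm (f x) \<partial>unit_measure) + (\<integral>x. norm (g x) \<partial>unit_measure)"
      using fg by simp
  qed
  show "norm (a *\<^sub>R f) = \<bar>a\<bar> * norm f"
    by transfer simp
qed (simp_all add: sgn_L1_def dist_L1_def uniformity_L1_def open_L1_def)

end

end

theory Submission
  imports Defs
begin

text \<open>
  Identify \<open>X\<close> with the direct sum of countably many copies of itself, let \<open>R\<close> and \<open>L\<close> be the right
  and left shifts of the sum, and regard operators on \<open>X\<close> as infinite matrices. If the columns of
  \<open>T\<close> decrease geometrically in norm, with the zeroth one arbitrary, then \<open>V = \<Sum>\<^sub>l L\<^sup>l T R\<^sup>l\<close>
  converges and satisfies \<open>V - L V R = T\<close>. It follows that \<open>T - [R, L V]\<close> has only a zeroth row, whose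
  entries decrease geometrically, and such a row is a commutator with \<open>R\<close> by a telescoping diagonal
  sum. So \<open>T\<close> is a commutator (\<open>commutator_of_small_columns\<close>). Dually, \<open>T\<close> is a commutator
  with \<open>L\<close> if its rows decrease geometrically (\<open>commutator_of_small_rows\<close>).

  Since the zeroth row and column are free, a sparse set of small columns or rows is enough. The projection
  \<open>P\<close> splits \<open>X\<close> into two copies of \<open>X\<close>, and \<open>P X\<close> is again a direct sum of countably many
  copies. If there are arbitrarily small ones in every tail of the columns of \<open>T P\<close>, or of the rows
  of \<open>P T\<close>, select a sparse subsequence of them and merge all the other summands, among them
  \<open>(I - P) X\<close>, into one copy of \<open>X\<close>. With that copy as the zeroth summand the rapid decrease is
  achieved by a similarity (\<open>commutator_of_inf_small_columns\<close>, \<open>commutator_of_inf_small_rows\<close>).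

  It remains to find small rows or columns of a compact operator \<open>K\<close>. The rows always tend to zero,
  because the coordinates do so uniformly on compact sets. So do the columns for \<open>p > 1\<close> and \<open>p = 0\<close>:
  otherwise the sum of \<open>m\<close> suitable unit vectors in different summands, of norm of order \<open>m\<^sup>1\<^sup>/\<^sup>p\<close>
  (or \<open>1\<close> if \<open>p = 0\<close>), would have an image of norm of order \<open>m\<close>.

  For \<open>p = 1\<close> the columns need not be small, as an operator of rank one on $\ell_1$ shows, and the
  summands have to be tilted. By compactness two columns \<open>K\<^sub>i\<close>, \<open>K\<^sub>j\<close> can be found which map the
  unit ball to almost the same set. On $\ell_1$ and $L_1$ compact operators can be lifted:
  there is \<open>V\<close> of norm at most one with \<open>K\<^sub>i\<close> close to \<open>K\<^sub>j V\<close> (\<open>lift_compact_operator\<close>). Then \<open>K\<close>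
  is small on the graph of \<open>- V\<close> in the sum of the two summands, and this graph can replace the
  \<open>i\<close>-th summand. The lifting is trivial on a finite-dimensional $\ell_1$-space, and passes to
  $\ell_1$ and $L_1$ by Tychonoff's theorem.
\<close>


section \<open>Sequence spaces\<close>

lemma bdd_above_norm_c0:
  assumes "(\<lambda>i. norm (f i)) \<longlonglongrightarrow> 0"
  shows "bdd_above (range (\<lambda>i. norm (f i)))"
  using assms by (metis convergentI convergent_imp_Bseq Bseq_eq_bounded bounded_imp_bdd_above)

lemma seq_norm_nonneg:
  assumes "f \<in> seq_sum p"
  shows "0 \<le> seq_norm p f"
proof (cases "p = 0")
  case True
  then have "bdd_above (range (\<lambda>i. norm (f i)))"
    using assms by (auto simp: seq_sum_def intro: bdd_above_norm_c0)
  then have "norm (f 0) \<le> (SUP i. norm (f i))"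
    by (intro cSUP_upper) auto
  then show ?thesis
    using True order_trans[OF norm_ge_zero] by (simp add: seq_norm_def)
qed (simp add: seq_norm_def)

lemma norm_le_seq_norm:
  assumes "1 \<le> p \<or> p = 0" and f: "f \<in> seq_sum p"
  shows "norm (f i) \<le> seq_norm p f"
proof (cases "p = 0")
  case True
  then have "bdd_above (range (\<lambda>i. norm (f i)))"
    using f by (auto simp: seq_sum_def intro: bdd_above_norm_c0)
  then show ?thesis
    using True by (auto simp: seq_norm_def intro: cSUP_upper)
next
  case False
  then have p: "1 \<le> p" and sm: "summable (\<lambda>i. norm (f i) powr p)"
    using assms by (auto simp: seq_sum_def)
  have "norm (f i) powr p \<le> (\<Sum>i. norm (f i) powr p)"
    using sum_le_suminf[OF sm, of "{i}"] by simp
  then have "(norm (f i) powr p) powr (1 / p) \<le> (\<Sum>i. norm (f i) powr p) powr (1 / p)"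
    using p by (intro powr_mono2) auto
  then show ?thesis
    using p by (simp add: seq_norm_def powr_powr)
qed

text \<open>
  The common form of shifts, diagonal operators, restrictions to a set of coordinates and the
  shears used below, so that one estimate serves for all of them.
\<close>

definition weighted_reindex :: "nat set \<Rightarrow> (nat \<Rightarrow> 'a \<Rightarrow> 'a) \<Rightarrow> (nat \<Rightarrow> nat) \<Rightarrow> (nat \<Rightarrow> 'a) \<Rightarrow> nat \<Rightarrow> 'a::zero"
  where "weighted_reindex S a \<tau> f = (\<lambda>i. if i \<in> S then a i (f (\<tau> i)) else 0)"

lemma weighted_reindex_seq_sum:
  fixes f :: "nat \<Rightarrow> 'a::real_normed_vector"
  assumes p: "1 \<le> p \<or> p = 0" and f: "f \<in> seq_sum p" and inj: "inj_on \<tau> S"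
    and a: "\<And>i y. norm (a i y) \<le> c * norm y" and c: "0 \<le> c"
  shows "weighted_reindex S a \<tau> f \<in> seq_sum p"
    and "seq_norm p (weighted_reindex S a \<tau> f) \<le> c * seq_norm p f"
proof -
  define g where "g = weighted_reindex S a \<tau> f"
  have g_le: "norm (g i) \<le> (if i \<in> S then c * norm (f (\<tau> i)) else 0)" for i
    using a by (simp add: g_def weighted_reindex_def)
  have "g \<in> seq_sum p \<and> seq_norm p g \<le> c * seq_norm p f"
  proof (cases "p = 0")
    case True
    have f0: "(\<lambda>i. norm (f i)) \<longlonglongrightarrow> 0"
      using f True by (simp add: seq_sum_def)
    have "(\<lambda>i. norm (g i)) \<longlonglongrightarrow> 0"
    proof (rule LIMSEQ_I)
      fix e :: real assume e: "0 < e"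
      then obtain M where M: "\<And>j. j \<ge> M \<Longrightarrow> norm (f j) < e / (c + 1)"
        using LIMSEQ_D[OF f0, of "e / (c + 1)"] c by auto
      have "finite (\<tau> -` {..<M} \<inter> S)"
        by (rule finite_vimage_IntI[OF _ inj]) simp
      then obtain n where n: "\<And>i. i \<in> S \<Longrightarrow> \<tau> i < M \<Longrightarrow> i < n"
        using finite_nat_set_iff_bounded[of "\<tau> -` {..<M} \<inter> S"] by auto
      have "norm (g i) < e" if "i \<ge> n" for i
      proof (cases "i \<in> S")
        case True
        then have "norm (f (\<tau> i)) < e / (c + 1)"
          using n M that by (meson not_less)
        then have "(c + 1) * norm (f (\<tau> i)) < e"
          using c by (simp add: field_simps)
        moreover have "c * norm (f (\<tau> i)) \<le> (c + 1) * norm (f (\<tau> i))"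
          by (intro mult_right_mono) auto
        ultimately show ?thesis
          using g_le[of i] True by simp
      qed (use g_le[of i] e in simp)
      then show "\<exists>n. \<forall>i\<ge>n. norm (norm (g i) - 0) < e"
        by auto
    qed
    then have "g \<in> seq_sum p"
      using True by (simp add: seq_sum_def)
    moreover have "norm (g i) \<le> c * seq_norm p f" for i
      using g_le[of i] norm_le_seq_norm[OF p f, of "\<tau> i"] c seq_norm_nonneg[OF f]
      by (auto intro: order_trans mult_left_mono split: if_splits)
    then have "(SUP i. norm (g i)) \<le> c * seq_norm p f"
      by (intro cSUP_least) auto
    ultimately show ?thesis
      using True by (simp add: seq_norm_def)
  next
    case False
    then have p1: "1 \<le> p" and sm: "summable (\<lambda>i. norm (f i) powr p)"
      using p f by (auto simp: seq_sum_def)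
    define U where "U = (\<Sum>i. norm (f i) powr p)"
    have U0: "0 \<le> U"
      unfolding U_def by (rule suminf_nonneg[OF sm]) simp
    have part: "(\<Sum>i<n. norm (g i) powr p) \<le> c powr p * U" for n
    proof -
      let ?I = "{..<n} \<inter> S"
      have "(\<Sum>i<n. norm (g i) powr p) = (\<Sum>i\<in>?I. norm (g i) powr p)"
        by (rule sum.mono_neutral_right) (auto simp: g_def weighted_reindex_def)
      also have "\<dots> \<le> (\<Sum>i\<in>?I. (c * norm (f (\<tau> i))) powr p)"
      proof (intro sum_mono powr_mono2)
        show "norm (g i) \<le> c * norm (f (\<tau> i))" if "i \<in> ?I" for i
          using g_le[of i] that by simp
      qed (use p1 in auto)
      also have "\<dots> = c powr p * (\<Sum>i\<in>?I. norm (f (\<tau> i)) powr p)"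
        using c by (simp add: powr_mult sum_distrib_left)
      also have "(\<Sum>i\<in>?I. norm (f (\<tau> i)) powr p) = (\<Sum>j\<in>\<tau> ` ?I. norm (f j) powr p)"
        using inj by (subst sum.reindex) (auto intro: inj_on_subset)
      also have "c powr p * (\<Sum>j\<in>\<tau> ` ?I. norm (f j) powr p) \<le> c powr p * U"
        unfolding U_def by (intro mult_left_mono sum_le_suminf[OF sm]) auto
      finally show ?thesis .
    qed
    have smg: "summable (\<lambda>i. norm (g i) powr p)"
      using part by (intro summableI_nonneg_bounded) auto
    have "(\<Sum>i. norm (g i) powr p) \<le> c powr p * U"
      using smg part by (rule suminf_le_const)
    then have "(\<Sum>i. norm (g i) powr p) powr (1 / p) \<le> (c powr p * U) powr (1 / p)"
      using p1 smg by (intro powr_mono2 suminf_nonneg) auto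
    also have "\<dots> = c * U powr (1 / p)"
      using p1 c U0 by (simp add: powr_mult powr_powr)
    finally show ?thesis
      using smg False by (simp add: seq_sum_def seq_norm_def U_def)
  qed
  then show "weighted_reindex S a \<tau> f \<in> seq_sum p"
    and "seq_norm p (weighted_reindex S a \<tau> f) \<le> c * seq_norm p f"
    by (auto simp: g_def)
qed

lemma finite_support_seq_sum:
  fixes f :: "nat \<Rightarrow> 'a::real_normed_vector"
  assumes "finite I" and "\<And>i. i \<notin> I \<Longrightarrow> f i = 0"
  shows "f \<in> seq_sum p"
proof -
  have "\<forall>\<^sub>F i in sequentially. i \<notin> I"
    using assms(1) unfolding finite_nat_set_iff_bounded eventually_sequentially
    by (meson not_less)
  then have "\<forall>\<^sub>F i in sequentially. norm (f i) = 0"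
    by eventually_elim (use assms in auto)
  then have "(\<lambda>i. norm (f i)) \<longlonglongrightarrow> 0"
    by (simp add: tendsto_eventually)
  moreover have "summable (\<lambda>i. norm (f i) powr p)"
    by (rule summable_finite[OF assms(1)]) (use assms(2) in auto)
  ultimately show ?thesis
    by (simp add: seq_sum_def)
qed

text \<open>
  It is through this bound that the exponent matters: for \<open>p > 1\<close> and for \<open>p = 0\<close> it is of
  smaller order than the number of nonzero coordinates.
\<close>

lemma seq_norm_finite_support_le:
  fixes f :: "nat \<Rightarrow> 'a::real_normed_vector"
  assumes "1 \<le> p \<or> p = 0" and "finite I" and "\<And>i. i \<notin> I \<Longrightarrow> f i = 0"
    and "\<And>i. norm (f i) \<le> b"
  shows "seq_norm p f \<le> (if p = 0 then b else b * real (card I) powr (1 / p))"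
proof -
  have b: "0 \<le> b"
    using assms(4) norm_ge_zero order_trans by blast
  show ?thesis
  proof (cases "p = 0")
    case True
    have "(SUP i. norm (f i)) \<le> b"
      using assms(4) by (intro cSUP_least) auto
    then show ?thesis
      using True by (simp add: seq_norm_def)
  next
    case False
    then have p: "1 \<le> p"
      using assms by auto
    have "(\<Sum>i. norm (f i) powr p) = (\<Sum>i\<in>I. norm (f i) powr p)"
      by (rule suminf_finite) (use assms in auto)
    also have "\<dots> \<le> (\<Sum>i\<in>I. b powr p)"
      using p assms(4) by (intro sum_mono powr_mono2) auto
    finally have "(\<Sum>i. norm (f i) powr p) \<le> real (card I) * b powr p"
      by simp
    then have "(\<Sum>i. norm (f i) powr p) powr (1 / p) \<le> (real (card I) * b powr p) powr (1 / p)"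
      using p assms(2,3) by (intro powr_mono2 suminf_nonneg summable_finite[of I]) auto
    also have "\<dots> = b * real (card I) powr (1 / p)"
      using p b by (simp add: powr_mult powr_powr)
    finally show ?thesis
      using False by (simp add: seq_norm_def)
  qed
qed

lemma seq_norm_tail_tendsto_0:
  fixes f :: "nat \<Rightarrow> 'a::real_normed_vector"
  assumes p: "1 \<le> p \<or> p = 0" and f: "f \<in> seq_sum p"
  shows "(\<lambda>n. seq_norm p (\<lambda>i. if i < n then 0 else f i)) \<longlonglongrightarrow> 0"
proof (cases "p = 0")
  case True
  have f0: "(\<lambda>i. norm (f i)) \<longlonglongrightarrow> 0"
    using f True by (simp add: seq_sum_def)
  have "(\<lambda>n. SUP i. norm (if i < n then 0 else f i)) \<longlonglongrightarrow> 0"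
  proof (rule LIMSEQ_I)
    fix e :: real assume e: "0 < e"
    then obtain M where M: "\<And>j. j \<ge> M \<Longrightarrow> norm (f j) < e / 2"
      using LIMSEQ_D[OF f0, of "e / 2"] by auto
    have "norm ((SUP i. norm (if i < n then 0 else f i)) - 0) < e" if "n \<ge> M" for n
    proof -
      have *: "norm (if i < n then 0 else f i) \<le> e / 2" for i
        using M[of i] that e by (auto intro: less_imp_le)
      then have "(SUP i. norm (if i < n then 0 else f i)) \<le> e / 2"
        by (intro cSUP_least) auto
      moreover have "norm (if 0 < n then 0 else f 0) \<le> (SUP i. norm (if i < n then 0 else f i))"
        using * by (intro cSUP_upper bdd_aboveI2[where M = "e / 2"]) auto
      then have "0 \<le> (SUP i. norm (if i < n then 0 else f i))"
        using norm_ge_zero order_trans by blast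
      ultimately show ?thesis
        using e by simp
    qed
    then show "\<exists>n0. \<forall>n\<ge>n0. norm ((SUP i. norm (if i < n then 0 else f i)) - 0) < e"
      by blast
  qed
  then show ?thesis
    using True by (simp add: seq_norm_def)
next
  case False
  then have p1: "1 \<le> p" and sm: "summable (\<lambda>i. norm (f i) powr p)"
    using p f by (auto simp: seq_sum_def)
  have "(\<Sum>i. norm (if i < n then 0 else f i) powr p) = (\<Sum>i. norm (f (i + n)) powr p)" for n
  proof -
    have "summable (\<lambda>i. norm (if i < n then 0 else f i) powr p)"
      by (rule summable_comparison_test'[OF sm, of 0]) auto
    from suminf_split_initial_segment[OF this, of n] show ?thesis
      by simp
  qed
  moreover have "(\<lambda>n. (\<Sum>i. norm (f (i + n)) powr p) powr (1 / p)) \<longlonglongrightarrow> 0 powr (1 / p)"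
    using p1 by (intro tendsto_powr' suminf_exist_split2 sm) (auto intro!: always_eventually suminf_nonneg summable_ignore_initial_segment sm)
  ultimately show ?thesis
    using False p1 by (simp add: seq_norm_def)
qed


section \<open>Bounded operators\<close>

locale scaled_space =
  fixes s :: "'k::{real_normed_field, euclidean_space} \<Rightarrow> 'a::banach \<Rightarrow> 'a"
  assumes scaling: "normed_scaling s"
begin

sublocale vector_space s
  using scaling by (simp add: normed_scaling_def)

lemma norm_scale: "norm (s c x) = norm c * norm x"
  and scale_of_real: "s (of_real r) x = r *\<^sub>R x"
  using scaling by (auto simp: normed_scaling_def)

abbreviation bop :: "('a \<Rightarrow> 'a) \<Rightarrow> bool"
  where "bop \<equiv> bounded_operator s"

lemma bopI:
  assumes "\<And>x y. T (x + y) = T x + T y" and "\<And>c x. T (s c x) = s c (T x)"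
    and "\<And>x. norm (T x) \<le> c * norm x"
  shows "bop T"
  unfolding bounded_operator_def Vector_Spaces.linear_iff
proof (intro conjI)
  show "bounded_linear T"
  proof (rule bounded_linear_intro)
    show "T (r *\<^sub>R x) = r *\<^sub>R T x" for r x
      using assms(2)[of "of_real r" x] by (simp only: scale_of_real)
    show "norm (T x) \<le> norm x * c" for x
      using assms(3) by (simp add: mult.commute)
  qed (rule assms(1))
qed (use assms vector_space_axioms in auto)

lemma bop_linear: "bop T \<Longrightarrow> bounded_linear T"
  and bop_add: "bop T \<Longrightarrow> T (x + y) = T x + T y"
  and bop_scale: "bop T \<Longrightarrow> T (s c x) = s c (T x)"
  by (auto simp: bounded_operator_def Vector_Spaces.linear_iff)

lemma bop_diff: "bop T \<Longrightarrow> T (x - y) = T x - T y"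
  and bop_zero: "bop T \<Longrightarrow> T 0 = 0"
  and bop_sum: "bop T \<Longrightarrow> T (sum g I) = (\<Sum>i\<in>I. T (g i))"
  by (auto simp: linear_simps dest!: bop_linear bounded_linear.linear intro: linear_sum)
    (simp_all add: linear_diff linear_neg linear_0 linear_sum)

lemma bop_suminf: "bop T \<Longrightarrow> summable g \<Longrightarrow> T (\<Sum>i. g i) = (\<Sum>i. T (g i))"
  and bop_summable: "bop T \<Longrightarrow> summable g \<Longrightarrow> summable (\<lambda>i. T (g i))"
  using bounded_linear.suminf[of T g] bounded_linear.summable[of T g] bop_linear by auto

lemma bop_bound:
  assumes "bop T"
  obtains c where "0 \<le> c" and "\<And>x. norm (T x) \<le> c * norm x"
  using bounded_linear.nonneg_bounded[OF bop_linear[OF assms]] by (metis mult.commute)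

lemma bop_id: "bop (\<lambda>x. x)"
  by (rule bopI[where c = 1]) auto

lemma bop_scale_const: "bop (s c)"
  by (rule bopI[where c = "norm c"]) (auto simp: scale_right_distrib norm_scale scale_left_commute)

lemma bop_comp:
  assumes "bop T" and "bop U"
  shows "bop (\<lambda>x. T (U x))"
proof -
  obtain b c where "0 \<le> b" "\<And>x. norm (T x) \<le> b * norm x" "\<And>x. norm (U x) \<le> c * norm x"
    using assms by (metis bop_bound)
  then have "norm (T (U x)) \<le> (b * c) * norm x" for x
    by (metis (no_types) mult.assoc mult_left_mono order_trans)
  then show ?thesis
    by (rule bopI[rotated 2]) (simp_all add: assms bop_add bop_scale)
qed

lemma bop_plus:
  assumes "bop T" and "bop U"
  shows "bop (\<lambda>x. T x + U x)"
proof -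
  obtain b c where "\<And>x. norm (T x) \<le> b * norm x" "\<And>x. norm (U x) \<le> c * norm x"
    using assms by (metis bop_bound)
  then have "norm (T x + U x) \<le> (b + c) * norm x" for x
    by (metis distrib_right norm_triangle_mono)
  then show ?thesis
    by (rule bopI[rotated 2])
      (simp_all add: assms bop_add bop_scale scale_right_distrib algebra_simps)
qed

lemma bop_uminus:
  assumes "bop T"
  shows "bop (\<lambda>x. - T x)"
proof -
  obtain c where "\<And>x. norm (T x) \<le> c * norm x"
    using assms by (metis bop_bound)
  then have "norm (- T x) \<le> c * norm x" for x
    by simp
  then show ?thesis
    by (rule bopI[rotated 2]) (simp_all add: assms bop_add bop_scale)
qed

lemma bop_minus_op: "bop T \<Longrightarrow> bop U \<Longrightarrow> bop (\<lambda>x. T x - U x)"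
  using bop_plus[of T "\<lambda>x. - U x"] bop_uminus by simp

lemma bop_funpow: "bop T \<Longrightarrow> bop (T ^^ n)"
  by (induction n) (auto simp: id_def comp_def intro: bop_id bop_comp)

lemma bop_norm_le_of_unit_ball:
  assumes F: "bop F" and le: "\<And>x. norm x \<le> 1 \<Longrightarrow> norm (F x) \<le> c"
  shows "norm (F x) \<le> c * norm x"
proof (cases "x = 0")
  case False
  have "norm (F x) = norm x * norm (F (x /\<^sub>R norm x))"
    using False linear_scale[OF bounded_linear.linear[OF bop_linear[OF F]]] by simp
  also have "\<dots> \<le> norm x * c"
    using False by (intro mult_left_mono le) auto
  finally show ?thesis
    by (simp add: mult.commute)
qed (simp add: bop_zero[OF F])

lemma bop_norm_convergent_series:
  assumes F: "\<And>l. bop (F l)" and le: "\<And>l x. norm (F l x) \<le> q l * norm x" and q: "summable q"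
  shows "summable (\<lambda>l. F l x)"
    and "bop (\<lambda>x. \<Sum>l. F l x)"
    and "norm (\<Sum>l. F l x) \<le> suminf q * norm x"
proof -
  have sm: "summable (\<lambda>l. F l x)" for x
    by (rule summable_comparison_test'[OF summable_mult2[OF q, of "norm x"], of 0]) (use le in auto)
  have bd: "norm (\<Sum>l. F l x) \<le> suminf q * norm x" for x
  proof -
    have "norm (\<Sum>l. F l x) \<le> (\<Sum>l. q l * norm x)"
      by (rule norm_suminf_le[OF le summable_mult2[OF q]])
    then show ?thesis
      using q by (simp add: suminf_mult2)
  qed
  show "bop (\<lambda>x. \<Sum>l. F l x)"
  proof (rule bopI[OF _ _ bd])
    show "(\<Sum>l. F l (x + y)) = (\<Sum>l. F l x) + (\<Sum>l. F l y)" for x y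
      using sm by (simp add: bop_add[OF F] suminf_add)
    show "(\<Sum>l. F l (s c x)) = s c (\<Sum>l. F l x)" for c x
      using bop_suminf[OF bop_scale_const sm] by (simp add: bop_scale[OF F])
  qed
  show "summable (\<lambda>l. F l x)" "norm (\<Sum>l. F l x) \<le> suminf q * norm x"
    by (fact sm, fact bd)
qed


section \<open>Splittings of the space into two copies of itself\<close>

text \<open>
  An isomorphism of the space with its own square, given by the two embeddings \<open>a\<close>, \<open>b\<close> and
  the two coordinate maps \<open>a'\<close>, \<open>b'\<close>.
\<close>

definition splitting :: "('a \<Rightarrow> 'a) \<Rightarrow> ('a \<Rightarrow> 'a) \<Rightarrow> ('a \<Rightarrow> 'a) \<Rightarrow> ('a \<Rightarrow> 'a) \<Rightarrow> bool"
  where "splitting a a' b b' \<longleftrightarrow> bop a \<and> bop a' \<and> bop b \<and> bop b' \<and>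
    (\<forall>x. a' (a x) = x) \<and> (\<forall>x. b' (b x) = x) \<and> (\<forall>x. a (a' x) + b (b' x) = x)"

lemma splittingD:
  assumes "splitting a a' b b'"
  shows "bop a" "bop a'" "bop b" "bop b'"
    and "a' (a x) = x" "b' (b x) = x" "a (a' x) + b (b' x) = x"
    and "a' (b x) = 0" "b' (a x) = 0"
proof -
  note S = assms[unfolded splitting_def]
  show "bop a" "bop a'" "bop b" "bop b'" "a' (a x) = x" "b' (b x) = x" "a (a' x) + b (b' x) = x"
    using S by auto
  have "a' (b x) = a' (a (a' (b x)) + b (b' (b x)))" "b' (a x) = b' (a (a' (a x)) + b (b' (a x)))"
    using S by metis+
  then show "a' (b x) = 0" "b' (a x) = 0"
    using S bop_add[of a'] bop_add[of b'] by (metis add_cancel_right_right add_cancel_left_left)+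
qed

text \<open>
  Splitting the first summand again and collecting the two remaining summands, which together
  are a copy of the space because the given splitting identifies it with its square.
\<close>

lemma splitting_refine:
  assumes ab: "splitting a a' b b'" and hk: "splitting h h' k k'"
  shows "splitting (\<lambda>x. a (h x)) (\<lambda>x. h' (a' x))
    (\<lambda>x. b (a' x) + a (k (b' x))) (\<lambda>x. a (b' x) + b (k' (a' x)))"
  unfolding splitting_def
proof (intro conjI allI)
  note A = splittingD[OF ab] and H = splittingD[OF hk]
  show "bop (\<lambda>x. a (h x))" "bop (\<lambda>x. h' (a' x))" "bop (\<lambda>x. b (a' x) + a (k (b' x)))"
    "bop (\<lambda>x. a (b' x) + b (k' (a' x)))"
    by (intro bop_plus A(1-4) H(1-4) A(1-4)[THEN bop_comp] H(1-4)[THEN bop_comp])+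
  fix x
  show "h' (a' (a (h x))) = x"
    by (simp add: A H)
  show "a (b' (b (a' x) + a (k (b' x)))) + b (k' (a' (b (a' x) + a (k (b' x))))) = x"
    by (simp add: A H bop_add[OF A(4)] bop_add[OF A(2)] bop_add[OF H(4)])
  have "a (h (h' (a' x))) + (b (a' (a (b' x) + b (k' (a' x)))) + a (k (b' (a (b' x) + b (k' (a' x))))))
      = a (h (h' (a' x)) + k (k' (a' x))) + b (b' x)"
    by (simp only: A(5,6,8,9) bop_add[OF A(4)] bop_add[OF A(2)] bop_add[OF A(1)] add_0_left
        add_0_right ac_simps)
  then show "a (h (h' (a' x))) + (b (a' (a (b' x) + b (k' (a' x)))) + a (k (b' (a (b' x) + b (k' (a' x))))))
      = x"
    by (simp add: A H)
qed

text \<open>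
  Any two splittings differ by the automorphism that matches their summands, so that an operator
  may be moved from one splitting to another.
\<close>

lemma commutator_transfer_splitting:
  assumes S: "splitting a a' b b'" and R: "splitting r r' t t'" and T: "bop T"
    and \<Psi>_def: "\<Psi> = (\<lambda>x. r (a' x) + t (b' x))" and \<Psi>'_def: "\<Psi>' = (\<lambda>x. a (r' x) + b (t' x))"
    and comm: "commutator s (\<lambda>x. \<Psi> (T (\<Psi>' x)))"
  shows "commutator s T"
proof -
  note A = splittingD[OF S] and H = splittingD[OF R]
  have \<Psi>: "bop \<Psi>" "bop \<Psi>'"
    unfolding \<Psi>_def \<Psi>'_def by (intro bop_plus A(1-4) H(1-4) A(1-4)[THEN bop_comp] H(1-4)[THEN bop_comp])+
  have inv: "\<Psi>' (\<Psi> x) = x" "\<Psi> (\<Psi>' x) = x" for x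
    by (simp_all add: \<Psi>_def \<Psi>'_def A H bop_add[OF A(2)] bop_add[OF A(4)] bop_add[OF H(2)]
        bop_add[OF H(4)])
  obtain G B where G: "bop G" and B: "bop B"
    and eq: "(\<lambda>x. \<Psi> (T (\<Psi>' x))) = (\<lambda>x. G (B x) - B (G x))"
    using comm unfolding commutator_def by blast
  have "T x = \<Psi>' (G (\<Psi> (\<Psi>' (B (\<Psi> x))))) - \<Psi>' (B (\<Psi> (\<Psi>' (G (\<Psi> x)))))" for x
  proof -
    have "T x = \<Psi>' (\<Psi> (T (\<Psi>' (\<Psi> x))))"
      by (simp add: inv)
    also have "\<dots> = \<Psi>' (G (B (\<Psi> x)) - B (G (\<Psi> x)))"
      using fun_cong[OF eq, of "\<Psi> x"] by simp
    finally show ?thesis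
      by (simp add: inv bop_diff[OF \<Psi>(2)])
  qed
  then show ?thesis
    unfolding commutator_def
    by (intro exI[of _ "\<lambda>x. \<Psi>' (G (\<Psi> x))"] exI[of _ "\<lambda>x. \<Psi>' (B (\<Psi> x))"] conjI ext)
      (intro \<Psi> G B \<Psi>[THEN bop_comp] G[THEN bop_comp] B[THEN bop_comp] | assumption)+
qed

end


section \<open>Coordinates, shifts and diagonal operators\<close>

locale sum_decomposition = scaled_space s
  for s :: "'k::{real_normed_field, euclidean_space} \<Rightarrow> 'a::banach \<Rightarrow> 'a" +
  fixes p :: real and J :: "'a \<Rightarrow> nat \<Rightarrow> 'a" and C :: real
  assumes exponent: "1 \<le> p \<or> p = 0"
    and J_bij: "linear_bijection s UNIV (seq_scale s) (seq_sum p) J"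
    and J_le: "seq_norm p (J x) \<le> C * norm x"
    and le_J: "norm x \<le> C * seq_norm p (J x)"
    and C_ge_1: "1 \<le> C"
begin

lemma J_mem: "J x \<in> seq_sum p"
  and J_add: "J (x + y) i = J x i + J y i"
  and J_scale: "J (s c x) i = s c (J x i)"
  and J_inj: "inj J"
  using J_bij by (auto simp: linear_bijection_def bij_betw_def seq_scale_def)

lemma coordinates_eqI: "(\<And>i. J x i = J y i) \<Longrightarrow> x = y"
  using J_inj by (auto dest: injD)

definition of_coordinates :: "(nat \<Rightarrow> 'a) \<Rightarrow> 'a"
  where "of_coordinates = inv_into UNIV J"

lemma J_of_coordinates: "f \<in> seq_sum p \<Longrightarrow> J (of_coordinates f) = f"
  using J_bij unfolding of_coordinates_def linear_bijection_def
  by (auto intro: bij_betw_inv_into_right)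

lemma norm_of_coordinates: "f \<in> seq_sum p \<Longrightarrow> norm (of_coordinates f) \<le> C * seq_norm p f"
  using le_J[of "of_coordinates f"] by (simp add: J_of_coordinates)

lemma norm_coordinate_le: "norm (J x i) \<le> C * norm x"
  using norm_le_seq_norm[OF exponent J_mem] J_le order_trans by blast

lemma bop_coordinate: "bop (\<lambda>x. J x i)"
  by (rule bopI[OF _ _ norm_coordinate_le]) (auto simp: J_add J_scale)

definition reindex :: "nat set \<Rightarrow> (nat \<Rightarrow> 'a \<Rightarrow> 'a) \<Rightarrow> (nat \<Rightarrow> nat) \<Rightarrow> 'a \<Rightarrow> 'a"
  where "reindex S a \<tau> x = of_coordinates (weighted_reindex S a \<tau> (J x))"

lemma reindex:
  assumes inj: "inj_on \<tau> S" and a: "\<And>i. bop (a i)" and le: "\<And>i y. norm (a i y) \<le> c * norm y"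
    and c: "0 \<le> c"
  shows J_reindex: "J (reindex S a \<tau> x) i = (if i \<in> S then a i (J x (\<tau> i)) else 0)"
    and norm_reindex: "norm (reindex S a \<tau> x) \<le> C * C * c * norm x"
    and bop_reindex: "bop (reindex S a \<tau>)"
proof -
  note mem = weighted_reindex_seq_sum(1)[OF exponent J_mem inj le c]
  have J_eq: "J (reindex S a \<tau> x) i = (if i \<in> S then a i (J x (\<tau> i)) else 0)" for x i
    unfolding reindex_def by (subst J_of_coordinates[OF mem]) (simp add: weighted_reindex_def)
  have bd: "norm (reindex S a \<tau> x) \<le> C * C * c * norm x" for x
  proof -
    have "norm (reindex S a \<tau> x) \<le> C * (c * seq_norm p (J x))"
      unfolding reindex_def
      using norm_of_coordinates[OF mem] weighted_reindex_seq_sum(2)[OF exponent J_mem inj le c]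
        C_ge_1 by (meson mult_left_mono order_trans zero_le_one)
    also have "\<dots> \<le> C * (c * (C * norm x))"
      using C_ge_1 c J_le by (intro mult_left_mono) auto
    finally show ?thesis
      by (simp add: mult_ac)
  qed
  show "bop (reindex S a \<tau>)"
    by (rule bopI[OF _ _ bd]; rule coordinates_eqI)
      (simp_all add: J_eq J_add J_scale bop_add[OF a] bop_scale[OF a])
  show "J (reindex S a \<tau> x) i = (if i \<in> S then a i (J x (\<tau> i)) else 0)"
    "norm (reindex S a \<tau> x) \<le> C * C * c * norm x"
    by (fact J_eq, fact bd)
qed

lemma reindex_id:
  assumes "inj_on \<tau> S"
  shows J_reindex_id: "J (reindex S (\<lambda>_ x. x) \<tau> x) i = (if i \<in> S then J x (\<tau> i) else 0)"
    and norm_reindex_id: "norm (reindex S (\<lambda>_ x. x) \<tau> x) \<le> C * C * norm x"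
    and bop_reindex_id: "bop (reindex S (\<lambda>_ x. x) \<tau>)"
  using reindex[OF assms, of "\<lambda>_ x. x" 1] bop_id by auto

definition ins :: "nat \<Rightarrow> 'a \<Rightarrow> 'a"
  where "ins i x = of_coordinates (\<lambda>k. if k = i then x else 0)"

lemma single_mem: "(\<lambda>k. if k = i then x else 0) \<in> seq_sum p" for x :: 'a
  by (rule finite_support_seq_sum[of "{i}"]) auto

lemma J_ins: "J (ins i x) k = (if k = i then x else 0)"
  unfolding ins_def by (subst J_of_coordinates) (simp_all add: single_mem)

lemma norm_ins_le: "norm (ins i x) \<le> C * norm x"
proof -
  let ?f = "\<lambda>k. if k = i then x else 0"
  have "seq_norm p ?f \<le> norm x"
    by (rule order_trans[OF seq_norm_finite_support_le[OF exponent, of "{i}" ?f "norm x"]]) auto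
  moreover have "norm (ins i x) \<le> C * seq_norm p ?f"
    unfolding ins_def by (rule norm_of_coordinates[OF single_mem])
  ultimately show ?thesis
    using C_ge_1 by (meson mult_left_mono order_trans zero_le_one)
qed

lemma bop_ins: "bop (ins i)"
  by (rule bopI[OF _ _ norm_ins_le]; rule coordinates_eqI) (auto simp: J_ins J_add J_scale)

lemma J_diff: "J (x - y) i = J x i - J y i"
  and J_sum: "J (\<Sum>j\<in>I. g j) i = (\<Sum>j\<in>I. J (g j) i)"
  and J_zero: "J 0 i = 0"
  using bop_diff[OF bop_coordinate] bop_sum[OF bop_coordinate] bop_zero[OF bop_coordinate]
  by blast+

lemma sums_coordinates: "(\<lambda>k. ins k (J x k)) sums x"
  unfolding sums_def
proof (rule LIM_zero_cancel, rule Lim_null_comparison)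
  show "\<forall>\<^sub>F n in sequentially. norm ((\<Sum>k<n. ins k (J x k)) - x)
      \<le> C * seq_norm p (\<lambda>i. if i < n then 0 else J x i)"
  proof (rule always_eventually, rule allI)
    fix n
    have "J (x - (\<Sum>k<n. ins k (J x k))) = (\<lambda>i. if i < n then 0 else J x i)"
      by (auto simp: J_diff J_sum J_ins fun_eq_iff)
    then show "norm ((\<Sum>k<n. ins k (J x k)) - x) \<le> C * seq_norm p (\<lambda>i. if i < n then 0 else J x i)"
      using le_J[of "x - (\<Sum>k<n. ins k (J x k))"] by (simp add: norm_minus_commute)
  qed
  show "(\<lambda>n. C * seq_norm p (\<lambda>i. if i < n then 0 else J x i)) \<longlonglongrightarrow> 0"
    using seq_norm_tail_tendsto_0[OF exponent J_mem[of x]] by (rule tendsto_mult_right_zero)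
qed

definition right_shift :: "'a \<Rightarrow> 'a"
  where "right_shift = reindex {0<..} (\<lambda>_ x. x) (\<lambda>i. i - 1)"

definition left_shift :: "'a \<Rightarrow> 'a"
  where "left_shift = reindex UNIV (\<lambda>_ x. x) Suc"

definition diagonal :: "('a \<Rightarrow> 'a) \<Rightarrow> 'a \<Rightarrow> 'a"
  where "diagonal v = reindex UNIV (\<lambda>_. v) id"

lemma inj_on_diff: "inj_on (\<lambda>i::nat. i - n) {n..}"
  by (auto simp: inj_on_def)

lemma J_right_shift: "J (right_shift x) i = (if i = 0 then 0 else J x (i - 1))"
  and bop_right_shift: "bop right_shift"
  and J_left_shift: "J (left_shift x) i = J x (Suc i)"
  and bop_left_shift: "bop left_shift"
proof -
  have inj: "inj_on (\<lambda>i::nat. i - 1) {0<..}" "inj_on Suc UNIV"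
    by (auto simp: inj_on_def)
  show "J (right_shift x) i = (if i = 0 then 0 else J x (i - 1))" "bop right_shift"
    "J (left_shift x) i = J x (Suc i)" "bop left_shift"
    using J_reindex_id[OF inj(1)] J_reindex_id[OF inj(2)] bop_reindex_id[OF inj(1)]
      bop_reindex_id[OF inj(2)]
    by (simp_all add: right_shift_def left_shift_def)
qed

lemma J_right_shift_pow: "J ((right_shift ^^ n) x) i = (if i < n then 0 else J x (i - n))"
  by (induction n arbitrary: i) (auto simp: J_right_shift)

lemma J_left_shift_pow: "J ((left_shift ^^ n) x) i = J x (i + n)"
  by (induction n arbitrary: i) (auto simp: J_left_shift)

lemma norm_right_shift_pow_le: "norm ((right_shift ^^ n) x) \<le> C * C * norm x"
proof -
  have "(right_shift ^^ n) x = reindex {n..} (\<lambda>_ x. x) (\<lambda>i. i - n) x"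
    by (rule coordinates_eqI) (simp add: J_right_shift_pow J_reindex_id[OF inj_on_diff])
  then show ?thesis
    using norm_reindex_id[OF inj_on_diff] by simp
qed

lemma norm_left_shift_pow_le: "norm ((left_shift ^^ n) x) \<le> C * C * norm x"
proof -
  have "(left_shift ^^ n) x = reindex UNIV (\<lambda>_ x. x) (\<lambda>i. i + n) x"
    by (rule coordinates_eqI) (simp add: J_left_shift_pow J_reindex_id)
  then show ?thesis
    using norm_reindex_id[of "\<lambda>i. i + n" UNIV] by simp
qed

lemma
  assumes "bop v" and "\<And>x. norm (v x) \<le> c * norm x" and "0 \<le> c"
  shows J_diagonal: "J (diagonal v x) i = v (J x i)"
    and norm_diagonal_le: "norm (diagonal v x) \<le> C * C * c * norm x"
    and bop_diagonal: "bop (diagonal v)"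
  unfolding diagonal_def using reindex[of id UNIV "\<lambda>_. v" c] assms by auto

text \<open>
  \<open>D - R D L\<close> cancels all entries of a constant diagonal but the zeroth. This is how an operator
  living in the zeroth summand becomes a commutator with a shift.
\<close>

lemma diagonal_telescope:
  assumes "bop v"
  shows "diagonal v x - right_shift (diagonal v (left_shift x)) = ins 0 (v (J x 0))"
proof -
  obtain c where "0 \<le> c" "\<And>x. norm (v x) \<le> c * norm x"
    using assms by (metis bop_bound)
  note D = J_diagonal[OF assms this(2,1)]
  show ?thesis
    by (rule coordinates_eqI) (simp add: J_diff J_right_shift J_ins J_left_shift D)
qed

lemma left_right_shift: "left_shift (right_shift x) = x"
  by (rule coordinates_eqI) (simp add: J_right_shift J_left_shift)

lemma right_left_shift: "right_shift (left_shift x) = x - ins 0 (J x 0)"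
  by (rule coordinates_eqI) (simp add: J_right_shift J_left_shift J_ins J_diff)

lemma shift_splitting: "splitting right_shift left_shift (ins 0) (\<lambda>x. J x 0)"
  unfolding splitting_def
  by (simp add: bop_right_shift bop_left_shift bop_ins bop_coordinate left_right_shift
      right_left_shift J_ins)

lemma ins_eq_right_shift_pow: "ins k x = (right_shift ^^ k) (ins 0 x)"
  by (rule coordinates_eqI) (auto simp: J_right_shift_pow J_ins)


section \<open>Operators with rapidly decreasing rows or columns\<close>

text \<open>
  For \<open>V = \<Sum>\<^sub>l L\<^sup>l T R\<^sup>l\<close> one has \<open>V - L V R = T\<close>, and so \<open>T\<close> differs from \<open>[R, L V]\<close> only in
  the zeroth row and from \<open>[L, - V R]\<close> only in the zeroth column. For \<open>l > 0\<close> the operator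
  \<open>L\<^sup>l T R\<^sup>l\<close> does not see the zeroth row and column of \<open>T\<close>; hence the zeroth summand can absorb
  whatever is not under control.
\<close>

lemma shift_conjugation_series:
  assumes T: "bop T"
    and le: "\<And>l x. norm ((left_shift ^^ l) (T ((right_shift ^^ l) x))) \<le> b * (1 / 2) ^ l * norm x"
  obtains V where "bop V" and "\<And>x. left_shift (V (right_shift x)) = V x - T x"
    and "\<And>x. (\<lambda>l. (left_shift ^^ l) (T ((right_shift ^^ l) x))) sums V x"
proof -
  define F where "F l x = (left_shift ^^ l) (T ((right_shift ^^ l) x))" for l x
  define V where "V x = (\<Sum>l. F l x)" for x
  have F: "bop (F l)" for l
    unfolding F_def
    by (intro bop_comp[OF bop_funpow[OF bop_left_shift]] bop_comp[OF T] bop_funpow bop_right_shift)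
  have q: "summable (\<lambda>l. b * (1 / 2) ^ l)"
    by (intro summable_mult summable_geometric) simp
  note series = bop_norm_convergent_series[where F = F, OF F le[folded F_def] q]
  have "left_shift (V (right_shift x)) = V x - T x" for x
  proof -
    have "left_shift (V (right_shift x)) = (\<Sum>l. left_shift (F l (right_shift x)))"
      unfolding V_def by (rule bop_suminf[OF bop_left_shift series(1)])
    also have "\<dots> = (\<Sum>l. F (Suc l) x)"
      by (simp add: F_def funpow_swap1)
    also have "\<dots> = V x - T x"
      using suminf_split_head[OF series(1)[of x]] by (simp add: V_def F_def)
    finally show ?thesis .
  qed
  moreover have "(\<lambda>l. F l x) sums V x" for x
    using series(1) by (simp add: V_def summable_sums)
  moreover have "bop V"
    unfolding V_def by (rule series(2))
  ultimately show ?thesis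
    using that by (simp add: F_def)
qed

lemma geometric_tail_le:
  fixes g :: "nat \<Rightarrow> 'a"
  assumes "g sums y" and "\<And>l. norm (g l) \<le> b * (1 / 2) ^ (l + k)"
  shows "norm y \<le> 2 * b * (1 / 2) ^ k"
proof -
  have sb: "(\<lambda>l. b * (1 / 2) ^ (l + k)) sums (2 * b * (1 / 2) ^ k)"
    using sums_mult[OF geometric_sums[of "1 / 2 :: real"], of "b * (1 / 2) ^ k"]
    by (simp add: power_add mult_ac)
  have "norm (suminf g) \<le> (\<Sum>l. b * (1 / 2) ^ (l + k))"
    using assms(2) sb by (intro norm_suminf_le) (auto simp: sums_iff)
  then show ?thesis
    using assms(1) sb by (simp add: sums_iff)
qed

text \<open>
  The zeroth row \<open>(v\<^sub>k)\<close> of \<open>V\<close> inherits the decay of the columns of \<open>T\<close>. By telescoping it is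
  the commutator of \<open>R\<close> with \<open>- W L\<close>, where \<open>W\<close> is the block Toeplitz operator
  \<open>\<Sum>\<^sub>k diag(v\<^sub>k) L\<^sup>k\<close>. Thus \<open>T = [R, L V - W L]\<close>.
\<close>

lemma commutator_of_small_columns:
  assumes T: "bop T" and b: "0 \<le> b"
    and le: "\<And>l x. norm (T ((right_shift ^^ l) x)) \<le> b * (1 / 2) ^ l * norm x"
  shows "commutator s T"
proof -
  define c where "c = C * C * b"
  have C0: "0 \<le> C" and c0: "0 \<le> c"
    using C_ge_1 b by (auto simp: c_def)
  have le': "norm ((left_shift ^^ l) (T ((right_shift ^^ (l + k)) x))) \<le> c * norm x * (1 / 2) ^ (l + k)"
    for l k x
  proof -
    have "norm ((left_shift ^^ l) (T ((right_shift ^^ (l + k)) x)))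
        \<le> C * C * (b * (1 / 2) ^ (l + k) * norm x)"
      using norm_left_shift_pow_le mult_left_mono[OF le zero_le_square] by (rule order_trans)
    then show ?thesis
      by (simp add: c_def mult_ac)
  qed
  have le0: "norm ((left_shift ^^ l) (T ((right_shift ^^ l) x))) \<le> c * (1 / 2) ^ l * norm x" for l x
    using le'[of l 0 x] by (simp add: mult_ac)
  obtain V where V: "bop V" and LVR: "\<And>x. left_shift (V (right_shift x)) = V x - T x"
    and V_sums: "\<And>x. (\<lambda>l. (left_shift ^^ l) (T ((right_shift ^^ l) x))) sums V x"
    using shift_conjugation_series[OF T le0] by blast
  define v where "v k x = J (V (ins k x)) 0" for k x
  have v: "bop (v k)" for k
    unfolding v_def by (rule bop_comp[OF bop_coordinate bop_comp[OF V bop_ins]])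
  define d where "d = C * (2 * (c * C))"
  have v_le: "norm (v k x) \<le> (d * (1 / 2) ^ k) * norm x" for k x
  proof -
    have "norm (V (ins k x)) \<le> 2 * (c * norm (ins 0 x)) * (1 / 2) ^ k"
    proof (rule geometric_tail_le)
      show "(\<lambda>l. (left_shift ^^ l) (T ((right_shift ^^ l) (ins k x)))) sums V (ins k x)"
        by (rule V_sums)
      show "norm ((left_shift ^^ l) (T ((right_shift ^^ l) (ins k x))))
          \<le> c * norm (ins 0 x) * (1 / 2) ^ (l + k)" for l
        using le'[of l k "ins 0 x"] by (simp add: ins_eq_right_shift_pow[of k] funpow_add)
    qed
    also have "\<dots> \<le> 2 * (c * (C * norm x)) * (1 / 2) ^ k"
      using c0 norm_ins_le by (intro mult_right_mono mult_left_mono) auto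
    finally show ?thesis
      using order_trans[OF norm_coordinate_le mult_left_mono[OF _ C0]]
      by (fastforce simp: v_def d_def mult_ac)
  qed
  have d0: "0 \<le> d * (1 / 2) ^ k" for k :: nat
    using C0 c0 by (simp add: d_def)
  note diag = J_diagonal[OF v v_le d0] norm_diagonal_le[OF v v_le d0] bop_diagonal[OF v v_le d0]
  define W where "W x = (\<Sum>k. diagonal (v k) ((left_shift ^^ k) x))" for x
  have F: "bop (\<lambda>x. diagonal (v k) ((left_shift ^^ k) x))" for k
    by (intro bop_comp[OF diag(3)] bop_funpow bop_left_shift)
  have F_le: "norm (diagonal (v k) ((left_shift ^^ k) x)) \<le> (C * C * d * (C * C)) * (1 / 2) ^ k * norm x"
    for k x
  proof -
    have "norm (diagonal (v k) ((left_shift ^^ k) x)) \<le> C * C * (d * (1 / 2) ^ k) * (C * C * norm x)"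
      using C0 d0 by (intro order_trans[OF diag(2)] mult_left_mono norm_left_shift_pow_le) auto
    then show ?thesis
      by (simp add: mult_ac)
  qed
  have q: "summable (\<lambda>k. (C * C * d * (C * C)) * (1 / 2) ^ k)"
    by (intro summable_mult summable_geometric) simp
  note series = bop_norm_convergent_series[OF F F_le q]
  have W: "bop W"
    unfolding W_def by (rule series(2))
  have W_telescope: "W x - right_shift (W (left_shift x)) = ins 0 (J (V x) 0)" for x
  proof -
    have "W x - right_shift (W (left_shift x))
        = (\<Sum>k. diagonal (v k) ((left_shift ^^ k) x)
            - right_shift (diagonal (v k) ((left_shift ^^ k) (left_shift x))))"
      unfolding W_def bop_suminf[OF bop_right_shift series(1)]
      by (intro suminf_diff series(1) bop_summable[OF bop_right_shift])
    also have "\<dots> = (\<Sum>k. ins 0 (J (V (ins k (J x k))) 0))"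
      using diagonal_telescope[OF v]
      by (simp add: funpow_swap1[of left_shift, symmetric] J_left_shift_pow v_def)
    also have "\<dots> = ins 0 (J (V x) 0)"
      using sums_coordinates[of x]
        bop_suminf[OF bop_comp[OF bop_ins bop_comp[OF bop_coordinate V]], of "\<lambda>k. ins k (J x k)" 0 0]
      by (simp add: sums_iff)
    finally show ?thesis .
  qed
  define B where "B x = left_shift (V x) - W (left_shift x)" for x
  have "bop B"
    unfolding B_def by (intro bop_minus_op bop_comp[OF bop_left_shift V] bop_comp[OF W bop_left_shift])
  moreover have "T x = right_shift (B x) - B (right_shift x)" for x
    using W_telescope[of x]
    by (simp add: B_def LVR left_right_shift right_left_shift bop_diff[OF bop_right_shift] algebra_simps)
  ultimately show ?thesis
    unfolding commutator_def using bop_right_shift by blast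
qed

text \<open>
  The same with rows and columns exchanged: the zeroth column \<open>(v\<^sub>k)\<close> of \<open>V\<close> is the commutator of
  \<open>L\<close> with \<open>R W\<close> for \<open>W = \<Sum>\<^sub>k R\<^sup>k diag(v\<^sub>k)\<close>, and \<open>T = [L, R W - V R]\<close>.
\<close>

lemma commutator_of_small_rows:
  assumes T: "bop T" and b: "0 \<le> b"
    and le: "\<And>l x. norm ((left_shift ^^ l) (T x)) \<le> b * (1 / 2) ^ l * norm x"
  shows "commutator s T"
proof -
  define c where "c = b * (C * C)"
  have C0: "0 \<le> C" and c0: "0 \<le> c"
    using C_ge_1 b by (auto simp: c_def)
  have le': "norm ((left_shift ^^ (k + l)) (T ((right_shift ^^ l) x))) \<le> c * norm x * (1 / 2) ^ (l + k)"
    for l k x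
  proof -
    have "norm ((left_shift ^^ (k + l)) (T ((right_shift ^^ l) x)))
        \<le> b * (1 / 2) ^ (k + l) * (C * C * norm x)"
      using b by (intro order_trans[OF le] mult_left_mono norm_right_shift_pow_le) auto
    then show ?thesis
      by (simp add: c_def mult_ac add.commute)
  qed
  have le0: "norm ((left_shift ^^ l) (T ((right_shift ^^ l) x))) \<le> c * (1 / 2) ^ l * norm x" for l x
    using le'[of 0 l x] by (simp add: mult_ac)
  obtain V where V: "bop V" and LVR: "\<And>x. left_shift (V (right_shift x)) = V x - T x"
    and V_sums: "\<And>x. (\<lambda>l. (left_shift ^^ l) (T ((right_shift ^^ l) x))) sums V x"
    using shift_conjugation_series[OF T le0] by blast
  define v where "v k x = J (V (ins 0 x)) k" for k x
  have v: "bop (v k)" for k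
    unfolding v_def by (rule bop_comp[OF bop_coordinate bop_comp[OF V bop_ins]])
  define d where "d = C * (2 * (c * C))"
  have v_le: "norm (v k x) \<le> (d * (1 / 2) ^ k) * norm x" for k x
  proof -
    have "norm ((left_shift ^^ k) (V (ins 0 x))) \<le> 2 * (c * norm (ins 0 x)) * (1 / 2) ^ k"
    proof (rule geometric_tail_le)
      show "(\<lambda>l. (left_shift ^^ k) ((left_shift ^^ l) (T ((right_shift ^^ l) (ins 0 x)))))
          sums (left_shift ^^ k) (V (ins 0 x))"
        by (rule bounded_linear.sums[OF bop_linear[OF bop_funpow[OF bop_left_shift]] V_sums])
      show "norm ((left_shift ^^ k) ((left_shift ^^ l) (T ((right_shift ^^ l) (ins 0 x)))))
          \<le> c * norm (ins 0 x) * (1 / 2) ^ (l + k)" for l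
        using le'[of k l "ins 0 x"] by (simp add: funpow_add)
    qed
    also have "\<dots> \<le> 2 * (c * (C * norm x)) * (1 / 2) ^ k"
      using c0 norm_ins_le by (intro mult_right_mono mult_left_mono) auto
    finally have "C * norm ((left_shift ^^ k) (V (ins 0 x))) \<le> C * (2 * (c * (C * norm x)) * (1 / 2) ^ k)"
      using C0 by (intro mult_left_mono)
    then show ?thesis
      using norm_coordinate_le[of "(left_shift ^^ k) (V (ins 0 x))" 0]
      by (simp add: v_def d_def mult_ac J_left_shift_pow)
  qed
  have d0: "0 \<le> d * (1 / 2) ^ k" for k :: nat
    using C0 c0 by (simp add: d_def)
  note diag = J_diagonal[OF v v_le d0] norm_diagonal_le[OF v v_le d0] bop_diagonal[OF v v_le d0]
  define W where "W x = (\<Sum>k. (right_shift ^^ k) (diagonal (v k) x))" for x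
  have F: "bop (\<lambda>x. (right_shift ^^ k) (diagonal (v k) x))" for k
    by (intro bop_comp[OF bop_funpow[OF bop_right_shift]] diag(3))
  have F_le: "norm ((right_shift ^^ k) (diagonal (v k) x)) \<le> (C * C * (C * C) * d) * (1 / 2) ^ k * norm x"
    for k x
  proof -
    have "norm ((right_shift ^^ k) (diagonal (v k) x)) \<le> C * C * (C * C * (d * (1 / 2) ^ k) * norm x)"
      using C0 by (intro order_trans[OF norm_right_shift_pow_le] mult_left_mono diag(2)) auto
    then show ?thesis
      by (simp add: mult_ac)
  qed
  have q: "summable (\<lambda>k. (C * C * (C * C) * d) * (1 / 2) ^ k)"
    by (intro summable_mult summable_geometric) simp
  note series = bop_norm_convergent_series[OF F F_le q]
  have W: "bop W"
    unfolding W_def by (rule series(2))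
  have W_telescope: "W x - right_shift (W (left_shift x)) = V (ins 0 (J x 0))" for x
  proof -
    have "W x - right_shift (W (left_shift x))
        = (\<Sum>k. (right_shift ^^ k) (diagonal (v k) x)
            - right_shift ((right_shift ^^ k) (diagonal (v k) (left_shift x))))"
      unfolding W_def bop_suminf[OF bop_right_shift series(1)]
      by (intro suminf_diff series(1) bop_summable[OF bop_right_shift])
    also have "\<dots> = (\<Sum>k. (right_shift ^^ k) (diagonal (v k) x - right_shift (diagonal (v k) (left_shift x))))"
      by (simp add: funpow_swap1[of right_shift] bop_diff[OF bop_funpow[OF bop_right_shift]])
    also have "\<dots> = (\<Sum>k. ins k (J (V (ins 0 (J x 0))) k))"
      using diagonal_telescope[OF v] by (simp add: ins_eq_right_shift_pow[symmetric] v_def)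
    also have "\<dots> = V (ins 0 (J x 0))"
      using sums_coordinates by (simp add: sums_iff)
    finally show ?thesis .
  qed
  define B where "B x = right_shift (W x) - V (right_shift x)" for x
  have "bop B"
    unfolding B_def by (intro bop_minus_op bop_comp[OF bop_right_shift W] bop_comp[OF V bop_right_shift])
  moreover have "T x = left_shift (B x) - B (left_shift x)" for x
    using W_telescope[of x]
    by (simp add: B_def LVR left_right_shift right_left_shift bop_diff[OF bop_left_shift]
        bop_diff[OF V] algebra_simps)
  ultimately show ?thesis
    unfolding commutator_def using bop_left_shift by blast
qed

end


section \<open>Infinitely many small rows or columns suffice\<close>

text \<open>The gaps leave infinitely many coordinates over, so that these again span a copy of the space.\<close>

lemma sparse_sequence:
  assumes "\<And>n N. \<exists>j\<ge>N. Q n j"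
  obtains g :: "nat \<Rightarrow> nat" where "\<And>n. Q n (g n)" and "inj g" and "infinite (- range g)"
proof -
  have "\<exists>g. \<forall>n. Q n (g n) \<and> Suc (Suc (g n)) \<le> g (Suc n)"
    using assms by (intro dependent_nat_choice) (auto dest: meta_spec)
  then obtain g where Q: "\<And>n. Q n (g n)" and step: "\<And>n. Suc (Suc (g n)) \<le> g (Suc n)"
    by blast
  have mono: "strict_mono g"
    using step by (intro strict_monoI_Suc) (metis Suc_le_lessD Suc_lessD)
  have "Suc (g n) \<noteq> g m" for n m
  proof (cases "m \<le> n")
    case True
    then have "g m \<le> g n"
      using mono by (simp add: strict_mono_less_eq)
    then show ?thesis
      by simp
  next
    case False
    then have "g (Suc n) \<le> g m"
      using mono by (simp add: strict_mono_less_eq)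
    then show ?thesis
      using step[of n] by simp
  qed
  then have "range (\<lambda>n. Suc (g n)) \<subseteq> - range g"
    by auto
  moreover have "inj (\<lambda>n. Suc (g n))"
    using strict_mono_imp_inj_on[OF mono] by (auto simp: inj_on_def)
  then have "infinite (range (\<lambda>n. Suc (g n)))"
    using finite_imageD by blast
  ultimately have "infinite (- range g)"
    using finite_subset by blast
  then show ?thesis
    using that Q strict_mono_imp_inj_on[OF mono] by blast
qed

context sum_decomposition
begin

lemma splitting_coordinates:
  assumes g: "inj g" and inf: "infinite (- range g)"
  obtains h h' k k' where "splitting h h' k k'"
    and "\<And>i x. h (ins i x) = ins (g i) x" and "\<And>x i. J (h' x) i = J x (g i)"
proof -
  obtain f :: "nat \<Rightarrow> nat" where f: "bij_betw f UNIV (- range g)"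
    using bij_enumerate[OF inf] by blast
  then have f_inj: "inj f" and f_range: "range f = - range g"
    by (auto simp: bij_betw_def)
  define emb where "emb u = reindex (range u) (\<lambda>_ x. x) (inv u)" for u :: "nat \<Rightarrow> nat"
  define res where "res u = reindex UNIV (\<lambda>_ x. x) u" for u :: "nat \<Rightarrow> nat"
  have emb: "J (emb u x) i = (if i \<in> range u then J x (inv u i) else 0)" "bop (emb u)" for u x i
    using reindex_id[OF inj_on_inv_into[of "range u" u UNIV]] by (auto simp: emb_def)
  have res: "J (res u x) i = J x (u i)" "bop (res u)" if "inj u" for u x i
    using reindex_id[OF that] by (auto simp: res_def)
  have cases: "(i \<in> range g \<and> i \<notin> range f) \<or> (i \<notin> range g \<and> i \<in> range f)" for i
    using f_range by auto
  have "splitting (emb g) (res g) (emb f) (res f)"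
    unfolding splitting_def
  proof (intro conjI allI)
    show "bop (emb g)" "bop (res g)" "bop (emb f)" "bop (res f)"
      using emb res g f_inj by auto
    fix x
    show "res g (emb g x) = x"
      by (rule coordinates_eqI) (simp add: res[OF g] emb g)
    show "res f (emb f x) = x"
      by (rule coordinates_eqI) (simp add: res[OF f_inj] emb f_inj)
    show "emb g (res g x) + emb f (res f x) = x"
    proof (rule coordinates_eqI)
      fix i
      show "J (emb g (res g x) + emb f (res f x)) i = J x i"
        using cases[of i]
        by (auto simp: J_add emb res[OF g] res[OF f_inj] g f_inj)
    qed
  qed
  moreover have "emb g (ins i x) = ins (g i) x" for i x
  proof (rule coordinates_eqI)
    show "J (emb g (ins i x)) j = J (ins (g i) x) j" for j
      by (cases "j \<in> range g") (auto simp: emb J_ins g inj_eq[OF g])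
  qed
  ultimately show ?thesis
    using that res(1)[OF g] by blast
qed

text \<open>
  All coordinates outside a sparse set of good ones are merged, together with the second summand
  of the given splitting, into a single zeroth coordinate. What remains are the columns in the
  good coordinates, and a suitable choice of these makes the columns decrease geometrically.
\<close>

lemma commutator_of_inf_small_columns:
  assumes T: "bop T" and ab: "splitting a a' b b'"
    and small: "\<And>\<epsilon> N. 0 < \<epsilon> \<Longrightarrow> \<exists>j\<ge>N. \<forall>x. norm (T (a (ins j x))) \<le> \<epsilon> * norm x"
  shows "commutator s T"
proof -
  obtain g where g: "\<And>n x. norm (T (a (ins (g n) x))) \<le> (1 / 2) ^ n * norm x"
    and inj: "inj g" and inf: "infinite (- range g)"
    using sparse_sequence[of "\<lambda>n j. \<forall>x. norm (T (a (ins j x))) \<le> (1 / 2) ^ n * norm x"] small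
    by (metis zero_less_divide_1_iff zero_less_numeral zero_less_power)
  obtain h h' k k' where hk: "splitting h h' k k'" and h: "\<And>i x. h (ins i x) = ins (g i) x"
    using splitting_coordinates[OF inj inf] by metis
  define \<delta> where "\<delta> = (\<lambda>x. b (a' x) + a (k (b' x)))"
  define \<delta>' where "\<delta>' = (\<lambda>x. a (b' x) + b (k' (a' x)))"
  have S: "splitting (\<lambda>x. a (h x)) (\<lambda>x. h' (a' x)) \<delta> \<delta>'"
    unfolding \<delta>_def \<delta>'_def by (rule splitting_refine[OF ab hk])
  note A = splittingD[OF ab] and H = splittingD[OF hk] and D = splittingD[OF S]
  define \<Psi> where "\<Psi> = (\<lambda>x. right_shift (h' (a' x)) + ins 0 (\<delta>' x))"
  define \<Psi>' where "\<Psi>' = (\<lambda>x. a (h (left_shift x)) + \<delta> (J x 0))"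
  have \<Psi>: "bop \<Psi>" "bop \<Psi>'"
    unfolding \<Psi>_def \<Psi>'_def
    by (intro bop_plus bop_comp[OF bop_right_shift D(2)] bop_comp[OF bop_ins D(4)]
        bop_comp[OF D(1) bop_left_shift] bop_comp[OF D(3) bop_coordinate])+
  obtain c where c0: "0 \<le> c" and c: "\<And>x. norm (\<Psi> x) \<le> c * norm x"
    using \<Psi>(1) by (metis bop_bound)
  have T': "bop (\<lambda>x. \<Psi> (T (\<Psi>' x)))"
    by (intro bop_comp[OF \<Psi>(1)] bop_comp[OF T] \<Psi>(2))
  obtain e where e0: "0 \<le> e" and e: "\<And>x. norm (\<Psi> (T (\<Psi>' x))) \<le> e * norm x"
    using T' by (metis bop_bound)
  \<comment> \<open>\<open>a \<circ> h\<close> places the \<open>i\<close>-th coordinate in the good coordinate \<open>g i\<close>, where \<open>T\<close> is smaller than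
    \<open>2\<^sup>-\<^sup>i\<close>; the factor \<open>2\<close> is the sum of the geometric series.\<close>
  have tail: "norm (T (a (h ((right_shift ^^ l) x)))) \<le> 2 * (C * norm x) * (1 / 2) ^ l" for l x
  proof (rule geometric_tail_le)
    have "bop (\<lambda>x. T (a (h ((right_shift ^^ l) x))))"
      by (intro bop_comp[OF T] bop_comp[OF A(1)] bop_comp[OF H(1)] bop_funpow bop_right_shift)
    from bounded_linear.sums[OF bop_linear[OF this] sums_coordinates]
    show "(\<lambda>i. T (a (h ((right_shift ^^ l) (ins i (J x i)))))) sums T (a (h ((right_shift ^^ l) x)))" .
    show "norm (T (a (h ((right_shift ^^ l) (ins i (J x i)))))) \<le> C * norm x * (1 / 2) ^ (i + l)" for i
    proof -
      have "(right_shift ^^ l) (ins i (J x i)) = ins (i + l) (J x i)"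
        by (rule coordinates_eqI) (auto simp: J_right_shift_pow J_ins)
      then have "norm (T (a (h ((right_shift ^^ l) (ins i (J x i)))))) \<le> (1 / 2) ^ (i + l) * norm (J x i)"
        using g by (simp add: h)
      also have "\<dots> \<le> (1 / 2) ^ (i + l) * (C * norm x)"
        by (intro mult_left_mono norm_coordinate_le) auto
      finally show ?thesis
        by (simp add: mult_ac)
    qed
  qed
  \<comment> \<open>For \<open>l > 0\<close> the range of \<open>\<Psi>' \<circ> R\<^sup>l\<close> involves good coordinates only; for \<open>l = 0\<close> any bound \<open>e\<close>
    will do.\<close>
  have "commutator s (\<lambda>x. \<Psi> (T (\<Psi>' x)))"
  proof (rule commutator_of_small_columns[OF T', where b = "e + 4 * c * C"])
    show "0 \<le> e + 4 * c * C"
      using e0 c0 C_ge_1 by simp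
    show "norm (\<Psi> (T (\<Psi>' ((right_shift ^^ l) x)))) \<le> (e + 4 * c * C) * (1 / 2) ^ l * norm x" for l x
    proof (cases l)
      case 0
      have "e * norm x \<le> (e + 4 * c * C) * norm x"
        using c0 C_ge_1 by (intro mult_right_mono) auto
      then show ?thesis
        using e[of x] 0 by simp
    next
      case (Suc m)
      then have "\<Psi>' ((right_shift ^^ l) x) = a (h ((right_shift ^^ m) x))"
        by (simp add: \<Psi>'_def left_right_shift J_right_shift bop_zero[OF D(3)])
      then have "norm (\<Psi> (T (\<Psi>' ((right_shift ^^ l) x)))) \<le> c * (2 * (C * norm x) * (1 / 2) ^ m)"
        using c0 by (simp only:) (intro order_trans[OF c] mult_left_mono tail)
      also have "\<dots> = (4 * c * C) * (1 / 2) ^ l * norm x"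
        by (simp add: Suc)
      also have "\<dots> \<le> (e + 4 * c * C) * (1 / 2) ^ l * norm x"
        using e0 by (intro mult_right_mono) auto
      finally show ?thesis .
    qed
  qed
  then show ?thesis
    using commutator_transfer_splitting[OF S shift_splitting T \<Psi>_def \<Psi>'_def] by blast
qed

lemma commutator_of_inf_small_rows:
  assumes T: "bop T" and ab: "splitting a a' b b'"
    and small: "\<And>\<epsilon> N. 0 < \<epsilon> \<Longrightarrow> \<exists>j\<ge>N. \<forall>x. norm (J (a' (T x)) j) \<le> \<epsilon> * norm x"
  shows "commutator s T"
proof -
  obtain g where g: "\<And>n x. norm (J (a' (T x)) (g n)) \<le> (1 / 2) ^ n * norm x"
    and inj: "inj g" and inf: "infinite (- range g)"
    using sparse_sequence[of "\<lambda>n j. \<forall>x. norm (J (a' (T x)) j) \<le> (1 / 2) ^ n * norm x"] small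
    by (metis zero_less_divide_1_iff zero_less_numeral zero_less_power)
  obtain h h' k k' where hk: "splitting h h' k k'" and h': "\<And>x i. J (h' x) i = J x (g i)"
    using splitting_coordinates[OF inj inf] by metis
  define \<delta> where "\<delta> = (\<lambda>x. b (a' x) + a (k (b' x)))"
  define \<delta>' where "\<delta>' = (\<lambda>x. a (b' x) + b (k' (a' x)))"
  have S: "splitting (\<lambda>x. a (h x)) (\<lambda>x. h' (a' x)) \<delta> \<delta>'"
    unfolding \<delta>_def \<delta>'_def by (rule splitting_refine[OF ab hk])
  note D = splittingD[OF S]
  define \<Psi> where "\<Psi> = (\<lambda>x. right_shift (h' (a' x)) + ins 0 (\<delta>' x))"
  define \<Psi>' where "\<Psi>' = (\<lambda>x. a (h (left_shift x)) + \<delta> (J x 0))"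
  have \<Psi>: "bop \<Psi>" "bop \<Psi>'"
    unfolding \<Psi>_def \<Psi>'_def
    by (intro bop_plus bop_comp[OF bop_right_shift D(2)] bop_comp[OF bop_ins D(4)]
        bop_comp[OF D(1) bop_left_shift] bop_comp[OF D(3) bop_coordinate])+
  obtain c where c0: "0 \<le> c" and c: "\<And>x. norm (\<Psi>' x) \<le> c * norm x"
    using \<Psi>(2) by (metis bop_bound)
  have T': "bop (\<lambda>x. \<Psi> (T (\<Psi>' x)))"
    by (intro bop_comp[OF \<Psi>(1)] bop_comp[OF T] \<Psi>(2))
  obtain e where e0: "0 \<le> e" and e: "\<And>x. norm (\<Psi> (T (\<Psi>' x))) \<le> e * norm x"
    using T' by (metis bop_bound)
  have tail: "norm ((left_shift ^^ l) (h' (a' (T x)))) \<le> 2 * (C * norm x) * (1 / 2) ^ l" for l x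
  proof (rule geometric_tail_le[OF sums_coordinates])
    show "norm (ins i (J ((left_shift ^^ l) (h' (a' (T x)))) i)) \<le> C * norm x * (1 / 2) ^ (i + l)" for i
    proof -
      have "norm (ins i (J ((left_shift ^^ l) (h' (a' (T x)))) i)) \<le> C * norm (J (a' (T x)) (g (i + l)))"
        by (rule order_trans[OF norm_ins_le]) (simp add: J_left_shift_pow h')
      also have "\<dots> \<le> C * ((1 / 2) ^ (i + l) * norm x)"
        using C_ge_1 by (intro mult_left_mono g) auto
      finally show ?thesis
        by (simp add: mult_ac)
    qed
  qed
  have "commutator s (\<lambda>x. \<Psi> (T (\<Psi>' x)))"
  proof (rule commutator_of_small_rows[OF T', where b = "e + 4 * c * C"])
    show "0 \<le> e + 4 * c * C"
      using e0 c0 C_ge_1 by simp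
    show "norm ((left_shift ^^ l) (\<Psi> (T (\<Psi>' x)))) \<le> (e + 4 * c * C) * (1 / 2) ^ l * norm x" for l x
    proof (cases l)
      case 0
      have "e * norm x \<le> (e + 4 * c * C) * norm x"
        using c0 C_ge_1 by (intro mult_right_mono) auto
      then show ?thesis
        using e[of x] 0 by simp
    next
      case (Suc m)
      have "left_shift (\<Psi> y) = h' (a' y)" for y
        by (rule coordinates_eqI) (simp add: \<Psi>_def J_left_shift J_right_shift J_ins J_add)
      then have "(left_shift ^^ l) (\<Psi> (T (\<Psi>' x))) = (left_shift ^^ m) (h' (a' (T (\<Psi>' x))))"
        by (simp add: Suc funpow_swap1)
      then have "norm ((left_shift ^^ l) (\<Psi> (T (\<Psi>' x)))) \<le> 2 * (C * norm (\<Psi>' x)) * (1 / 2) ^ m"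
        using tail by simp
      also have "\<dots> \<le> 2 * (C * (c * norm x)) * (1 / 2) ^ m"
        using C_ge_1 by (intro mult_right_mono mult_left_mono c) auto
      also have "\<dots> = (4 * c * C) * (1 / 2) ^ l * norm x"
        by (simp add: Suc)
      also have "\<dots> \<le> (e + 4 * c * C) * (1 / 2) ^ l * norm x"
        using e0 by (intro mult_right_mono) auto
      finally show ?thesis .
    qed
  qed
  then show ?thesis
    using commutator_transfer_splitting[OF S shift_splitting T \<Psi>_def \<Psi>'_def] by blast
qed


section \<open>Compact operators have small rows, and small columns unless \<open>p = 1\<close>\<close>

text \<open>The coordinates of a vector tend to zero, and uniformly so on a compact set.\<close>

lemma compact_rows_small:
  assumes K: "bop K" and D: "compact D" and KD: "K ` cball 0 1 \<subseteq> D" and \<epsilon>: "0 < \<epsilon>"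
  shows "\<exists>j\<ge>N. \<forall>x. norm (J (K x) j) \<le> \<epsilon> * norm x"
proof -
  have "0 < \<epsilon> / (2 * C)"
    using \<epsilon> C_ge_1 by simp
  then obtain F where F: "finite F" and cover: "D \<subseteq> (\<Union>y\<in>F. ball y (\<epsilon> / (2 * C)))"
    using D unfolding compact_eq_totally_bounded by blast
  have "\<forall>\<^sub>F j in sequentially. norm (J y j) < \<epsilon> / 2" for y
  proof -
    have "(\<lambda>j. C * norm (ins j (J y j))) \<longlonglongrightarrow> 0"
      by (intro tendsto_mult_right_zero tendsto_norm_zero summable_LIMSEQ_zero
          sums_summable[OF sums_coordinates])
    then have "(\<lambda>j. norm (J y j)) \<longlonglongrightarrow> 0"
    proof (rule Lim_null_comparison[rotated])
      show "\<forall>\<^sub>F j in sequentially. norm (norm (J y j)) \<le> C * norm (ins j (J y j))"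
      proof (intro always_eventually allI)
        show "norm (norm (J y j)) \<le> C * norm (ins j (J y j))" for j
          using norm_coordinate_le[of "ins j (J y j)" j] by (simp add: J_ins)
      qed
    qed
    then show ?thesis
      using \<epsilon> by (intro order_tendstoD(2)[of _ 0]) auto
  qed
  then have "\<forall>\<^sub>F j in sequentially. \<forall>y\<in>F. norm (J y j) < \<epsilon> / 2"
    using F by (simp add: eventually_ball_finite)
  then obtain M where M: "\<And>j y. j \<ge> M \<Longrightarrow> y \<in> F \<Longrightarrow> norm (J y j) < \<epsilon> / 2"
    unfolding eventually_sequentially by blast
  have "norm (J (K x) j) \<le> \<epsilon> * norm x" if j: "j \<ge> M" for x j
  proof (rule bop_norm_le_of_unit_ball[OF bop_comp[OF bop_coordinate K]])
    fix x :: 'a assume "norm x \<le> 1"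
    then have "K x \<in> D"
      using KD by auto
    then obtain y where y: "y \<in> F" "norm (K x - y) < \<epsilon> / (2 * C)"
      using cover by (force simp: dist_norm norm_minus_commute)
    have "norm (J (K x - y) j) \<le> C * (\<epsilon> / (2 * C))"
      using y(2) C_ge_1 by (intro order_trans[OF norm_coordinate_le] mult_left_mono) auto
    also have "\<dots> = \<epsilon> / 2"
      using C_ge_1 by simp
    finally have "norm (J (K x - y) j) \<le> \<epsilon> / 2" .
    moreover have "norm (J (K x) j) \<le> norm (J (K x - y) j) + norm (J y j)"
      using norm_triangle_ineq[of "J (K x - y) j" "J y j"] by (simp add: J_diff)
    ultimately show "norm (J (K x) j) \<le> \<epsilon>"
      using M[OF j y(1)] by simp
  qed
  then show ?thesis
    by (intro exI[of _ "max M N"]) auto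
qed

text \<open>
  If the columns of \<open>K\<close> stayed large, suitable vectors in different coordinates would have almost
  equal images, and a sum of \<open>m\<close> of them would be mapped to a vector of norm of order \<open>m\<close>.
\<close>

lemma compact_columns_small:
  assumes K: "bop K" and D: "compact D" and KD: "K ` cball 0 1 \<subseteq> D" and \<epsilon>: "0 < \<epsilon>"
    and p: "p \<noteq> 1"
  shows "\<exists>j\<ge>N. \<forall>x. norm (K (ins j x)) \<le> \<epsilon> * norm x"
proof (rule ccontr)
  assume "\<not> ?thesis"
  then have large: "\<And>j. j \<ge> N \<Longrightarrow> \<exists>x. \<not> norm (K (ins j x)) \<le> \<epsilon> * norm x"
    by blast
  \<comment> \<open>Each \<open>ins j\<close> maps the ball of radius \<open>1 / C\<close> into the unit ball.\<close>
  define e where "e = \<epsilon> / C"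
  have e0: "0 < e"
    using \<epsilon> C_ge_1 by (simp add: e_def)
  have "\<exists>x. norm x \<le> 1 / C \<and> e < norm (K (ins j x))" if "j \<ge> N" for j
  proof (rule ccontr)
    assume *: "\<not> ?thesis"
    have "norm (K (ins j x)) \<le> \<epsilon> * norm x" for x
    proof (rule bop_norm_le_of_unit_ball[OF bop_comp[OF K bop_ins]])
      fix x :: 'a assume "norm x \<le> 1"
      then have "norm (x /\<^sub>R C) \<le> 1 / C"
        using C_ge_1 by (simp add: divide_simps)
      then have "norm (K (ins j (x /\<^sub>R C))) \<le> e"
        using * by (meson not_le)
      moreover have "K (ins j (x /\<^sub>R C)) = K (ins j x) /\<^sub>R C"
        using linear_scale[OF bounded_linear.linear[OF bop_linear[OF bop_comp[OF K bop_ins]]]] .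
      ultimately show "norm (K (ins j x)) \<le> \<epsilon>"
        using C_ge_1 by (simp add: e_def divide_simps)
    qed
    then show False
      using large[OF that] by blast
  qed
  then obtain z where z: "\<And>j. j \<ge> N \<Longrightarrow> norm (z j) \<le> 1 / C"
    and Kz: "\<And>j. j \<ge> N \<Longrightarrow> e < norm (K (ins j (z j)))"
    by metis
  define y where "y n = K (ins (N + n) (z (N + n)))" for n
  have y_D: "y n \<in> D" for n
  proof -
    have "norm (ins (N + n) (z (N + n))) \<le> C * (1 / C)"
      using z[of "N + n"] C_ge_1 by (intro order_trans[OF norm_ins_le] mult_left_mono) auto
    then show ?thesis
      using KD C_ge_1 by (auto simp: y_def)
  qed
  obtain w r where r: "strict_mono r" and lim: "(y \<circ> r) \<longlonglongrightarrow> w"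
    using D[unfolded compact_def] y_D by metis
  have "e \<le> norm w"
    by (rule tendsto_lowerbound[OF tendsto_norm[OF lim]])
      (use Kz in \<open>auto simp: y_def intro!: always_eventually less_imp_le[of e]\<close>)
  obtain M where M: "\<And>n. n \<ge> M \<Longrightarrow> norm (y (r n) - w) < e / 2"
    using LIMSEQ_D[OF lim, of "e / 2"] e0 by auto
  obtain c where c0: "0 \<le> c" and c: "\<And>x. norm (K x) \<le> c * norm x"
    using K by (metis bop_bound)
  \<comment> \<open>For \<open>p = 0\<close> the convention \<open>1 / 0 = 0\<close> turns the right-hand side into \<open>c\<close>, as it should be.\<close>
  have growth: "real m * (e / 2) \<le> c * real m powr (1 / p)" if m: "0 < m" for m
  proof -
    define t where "t i = N + r (M + i)" for i
    have t: "inj t"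
      using r by (auto simp: t_def strict_mono_eq intro!: injI)
    define x where "x = (\<Sum>i<m. ins (t i) (z (t i)))"
    have Jx: "J x j = (if j \<in> t ` {..<m} then z j else 0)" for j
    proof (cases "j \<in> t ` {..<m}")
      case True
      then obtain i where i: "i < m" "j = t i"
        by auto
      have "J x j = (\<Sum>i'<m. if i' = i then z j else 0)"
        unfolding x_def J_sum by (intro sum.cong) (auto simp: J_ins i inj_eq[OF t])
      then show ?thesis
        using True i by simp
    qed (auto simp: x_def J_sum J_ins intro!: sum.neutral)
    have "card (t ` {..<m}) = m"
      using t by (subst card_image) (auto intro: inj_on_subset)
    moreover have "norm (J x j) \<le> 1 / C" for j
      using z C_ge_1 by (auto simp: Jx t_def)
    ultimately have "seq_norm p (J x) \<le> 1 / C * real m powr (1 / p)"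
      using seq_norm_finite_support_le[OF exponent, of "t ` {..<m}" "J x" "1 / C"] m Jx
      by (auto split: if_splits)
    then have "norm x \<le> C * (1 / C * real m powr (1 / p))"
      using C_ge_1 by (intro order_trans[OF le_J] mult_left_mono) auto
    then have "norm x \<le> real m powr (1 / p)"
      using C_ge_1 by simp
    then have upper: "norm (K x) \<le> c * real m powr (1 / p)"
      using c0 by (intro order_trans[OF c] mult_left_mono)
    have "K x = (\<Sum>i<m. y (r (M + i)))"
      by (simp add: x_def bop_sum[OF K] y_def t_def)
    then have "K x - real m *\<^sub>R w = (\<Sum>i<m. y (r (M + i)) - w)"
      by (simp add: sum_subtractf sum_constant_scaleR)
    then have "norm (K x - real m *\<^sub>R w) \<le> (\<Sum>i<m. e / 2)"
      using M by (simp only:) (intro sum_norm_le less_imp_le, simp)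
    then have "norm (real m *\<^sub>R w) - real m * (e / 2) \<le> norm (K x)"
      using norm_triangle_ineq2[of "real m *\<^sub>R w" "K x"] by (simp add: norm_minus_commute)
    moreover have "real m * e \<le> norm (real m *\<^sub>R w)"
      using \<open>e \<le> norm w\<close> by (simp add: mult_left_mono)
    ultimately show ?thesis
      using upper by simp
  qed
  \<comment> \<open>Since \<open>1 / p < 1\<close>, the linear growth wins: take \<open>m\<^sup>u > 2 c / e\<close>.\<close>
  define u where "u = 1 - 1 / p"
  have u: "0 < u"
    using exponent p by (auto simp: u_def)
  define m where "m = Suc (nat \<lceil>(2 * c / e + 1) powr (1 / u)\<rceil>)"
  have m0: "0 < m"
    by (simp add: m_def)
  have "(2 * c / e + 1) powr (1 / u) \<le> real m"
    unfolding m_def by linarith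
  then have "((2 * c / e + 1) powr (1 / u)) powr u \<le> real m powr u"
    using u by (intro powr_mono2) auto
  then have "2 * c / e + 1 \<le> real m powr u"
    using u c0 e0 by (simp add: powr_powr)
  then have "(2 * c / e + 1) * real m powr (1 / p) \<le> real m powr u * real m powr (1 / p)"
    by (intro mult_right_mono) auto
  also have "\<dots> = real m"
    using m0 by (simp add: u_def powr_add[symmetric])
  also have "\<dots> \<le> 2 * c / e * real m powr (1 / p)"
    using growth[OF m0] e0 by (simp add: field_simps)
  finally show False
    using m0 by (simp add: algebra_simps)
qed

end


section \<open>Lifting operators from $\ell_1$ and $L_1$\<close>

text \<open>
  The identity is a pointwise limit of operators that factor through finite-dimensional
  $\ell_1$-spaces with both factors of norm at most one.
\<close>

definition ell1_approximable ::
    "('k::real_normed_field \<Rightarrow> 'b::real_normed_vector \<Rightarrow> 'b) \<Rightarrow> bool" where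
  "ell1_approximable s \<longleftrightarrow> (\<forall>F \<epsilon>. finite F \<longrightarrow> 0 < \<epsilon> \<longrightarrow>
     (\<exists>(d::nat) \<phi> e. (\<forall>k x y. \<phi> k (x + y) = \<phi> k x + \<phi> k y) \<and> (\<forall>k c x. \<phi> k (s c x) = c * \<phi> k x) \<and>
        (\<forall>x. (\<Sum>k<d. norm (\<phi> k x)) \<le> norm x) \<and> (\<forall>k. norm (e k) \<le> 1) \<and>
        (\<forall>x\<in>F. norm (x - (\<Sum>k<d. s (\<phi> k x) (e k))) \<le> \<epsilon>)))"

context scaled_space
begin

lemma compact_scale_image: "compact {s c z |c. norm c \<le> r}"
proof -
  have "bounded_linear (\<lambda>c. s c z)"
  proof (rule bounded_linear_intro)
    show "s (r *\<^sub>R c) z = r *\<^sub>R s c z" for r c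
      by (metis scale_of_real scale_scale scaleR_conv_of_real)
    show "norm (s c z) \<le> norm c * norm z" for c
      by (simp add: norm_scale)
  qed (rule scale_left_distrib)
  then have "compact ((\<lambda>c. s c z) ` cball 0 r)"
    by (intro compact_continuous_image linear_continuous_on compact_cball)
  moreover have "(\<lambda>c. s c z) ` cball 0 r = {s c z |c. norm c \<le> r}"
    by auto
  ultimately show ?thesis
    by simp
qed

lemma compact_scale_combinations:
  assumes "finite Z"
  shows "compact {\<Sum>z\<in>Z. s (c z) z |c. \<forall>z. norm (c z) \<le> r}"
  using assms
proof (induction Z)
  case empty
  have "{\<Sum>z\<in>{}. s (c z) z |c :: 'a \<Rightarrow> 'k. \<forall>z. norm (c z) \<le> r} \<subseteq> {0}"
    by auto
  then show ?case
    by (rule finite_imp_compact[OF finite_subset]) simp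
next
  case (insert z Z)
  let ?G = "\<lambda>Z. {\<Sum>z\<in>Z. s (c z) z |c. \<forall>z. norm (c z) \<le> r}"
  have "?G (insert z Z) = {x + y |x y. x \<in> {s c z |c. norm c \<le> r} \<and> y \<in> ?G Z}" (is "_ = ?R")
  proof
    show "?G (insert z Z) \<subseteq> ?R"
      using insert.hyps by auto
    show "?R \<subseteq> ?G (insert z Z)"
    proof
      fix w assume "w \<in> ?R"
      then obtain c0 c where w: "w = s c0 z + (\<Sum>z\<in>Z. s (c z) z)"
        and "norm c0 \<le> r" "\<And>z. norm (c z) \<le> r"
        by blast
      moreover have "(\<Sum>y\<in>Z. s ((c(z := c0)) y) y) = (\<Sum>z\<in>Z. s (c z) z)"
        using insert.hyps by (intro sum.cong) auto
      ultimately show "w \<in> ?G (insert z Z)"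
        using insert.hyps by (intro CollectI exI[of _ "c(z := c0)"]) auto
    qed
  qed
  then show ?case
    using compact_sums[OF compact_scale_image insert.IH] by simp
qed

text \<open>
  Let \<open>A\<close> be compact and let the image of the unit ball under \<open>A\<close> lie near the one under \<open>B\<close>.
  On a finite-dimensional $\ell_1$-space, \<open>A\<close> is lifted through \<open>B\<close> by lifting the images of the
  unit vectors, and these lifts may be taken from one finite subset of the unit ball. Hence the
  values at \<open>f\<close> of all these partial lifts stay in one compact set, and
  Tychonoff's theorem gives a limit.
\<close>

lemma lift_compact_operator:
  assumes approx: "ell1_approximable s" and A: "bop A" and B: "bop B"
    and D: "compact D" and AD: "A ` cball 0 1 \<subseteq> D" and \<delta>: "0 < \<delta>"
    and near: "\<And>x. norm x \<le> 1 \<Longrightarrow> \<exists>x'. norm x' \<le> 1 \<and> norm (A x - B x') \<le> \<delta>"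
  obtains V where "bop V" and "\<And>x. norm (V x) \<le> norm x"
    and "\<And>x. norm (A x - B (V x)) \<le> 4 * \<delta> * norm x"
proof -
  have "0 < \<delta> / 2"
    using \<delta> by simp
  then obtain Y where Y: "finite Y" "D \<subseteq> (\<Union>y\<in>Y. ball y (\<delta> / 2))"
    using D unfolding compact_eq_totally_bounded by blast
  \<comment> \<open>One lift for each net point that is close to the image of the unit ball under \<open>B\<close>.\<close>
  define near_ball where "near_ball y z \<longleftrightarrow> norm z \<le> 1 \<and> norm (y - B z) \<le> 3 / 2 * \<delta>" for y z
  define Z where "Z = (\<lambda>y. SOME z. near_ball y z) ` {y\<in>Y. \<exists>z. near_ball y z}"
  have Z: "finite Z" and Z_le: "\<And>z. z \<in> Z \<Longrightarrow> norm z \<le> 1"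
  proof -
    show "finite Z"
      using Y(1) by (simp add: Z_def)
    have "near_ball y (SOME z. near_ball y z)" if "near_ball y z" for y z
      using that by (rule someI)
    then show "norm z \<le> 1" if "z \<in> Z" for z
      using that by (auto simp: Z_def) (auto simp: near_ball_def)
  qed
  have Z_near: "\<exists>z\<in>Z. norm (A x - B z) \<le> 2 * \<delta>" if x: "norm x \<le> 1" for x
  proof -
    obtain y where y: "y \<in> Y" "norm (A x - y) < \<delta> / 2"
      using x AD Y(2) by (fastforce simp: dist_norm norm_minus_commute)
    obtain x' where x': "norm x' \<le> 1" "norm (A x - B x') \<le> \<delta>"
      using near[OF x] by blast
    have "norm (y - B x') \<le> norm (A x - y) + norm (A x - B x')"
      using norm_triangle_ineq4[of "A x - B x'" "A x - y"] by simp
    then have ex: "\<exists>z. near_ball y z"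
      using x' y(2) by (intro exI[of _ x']) (simp add: near_ball_def)
    define z where "z = (SOME z. near_ball y z)"
    have z: "near_ball y z"
      unfolding z_def by (rule someI_ex[OF ex])
    moreover have "z \<in> Z"
      using ex y(1) by (auto simp: Z_def z_def)
    moreover have "norm (A x - B z) \<le> norm (A x - y) + norm (y - B z)"
      using norm_triangle_ineq[of "A x - y" "y - B z"] by simp
    ultimately show ?thesis
      using y(2) by (intro bexI[of _ z]) (auto simp: near_ball_def)
  qed
  define G where "G f = {\<Sum>z\<in>Z. s (c z) z |c. \<forall>z. norm (c z) \<le> norm f}" for f :: 'a
  define U where "U = {V. (\<forall>f. V f \<in> G f) \<and> (\<forall>f g. V (f + g) = V f + V g) \<and>
    (\<forall>c f. V (s c f) = s c (V f)) \<and> (\<forall>f. norm (V f) \<le> norm f)}"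
  define good where "good f = {V. norm (A f - B (V f)) \<le> 4 * \<delta> * norm f}" for f
  have coord: "continuous_on UNIV (\<lambda>V::'a \<Rightarrow> 'a. V f)" for f
    by simp
  have cont_scale: "continuous_on UNIV (\<lambda>V::'a \<Rightarrow> 'a. s c (V f))" for c f
    by (rule bounded_linear.continuous_on[OF bop_linear[OF bop_scale_const] coord])
  have cont_B: "continuous_on UNIV (\<lambda>V::'a \<Rightarrow> 'a. B (V f))" for f
    by (rule bounded_linear.continuous_on[OF bop_linear[OF B] coord])
  have U: "compact U"
  proof -
    have "compactin (product_topology (\<lambda>_. euclidean) UNIV) (PiE UNIV G)"
      unfolding compactin_PiE by (simp add: G_def compact_scale_combinations[OF Z])
    then have "compact (PiE UNIV G)"
      by (simp add: euclidean_product_topology)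
    moreover have "closed {V::'a \<Rightarrow> 'a. (\<forall>f g. V (f + g) = V f + V g) \<and>
        (\<forall>c f. V (s c f) = s c (V f)) \<and> (\<forall>f. norm (V f) \<le> norm f)}"
      by (intro closed_Collect_conj closed_Collect_all closed_Collect_eq closed_Collect_le
          continuous_on_add continuous_on_norm coord cont_scale continuous_on_const)
    ultimately have "compact (PiE UNIV G \<inter> {V::'a \<Rightarrow> 'a. (\<forall>f g. V (f + g) = V f + V g) \<and>
        (\<forall>c f. V (s c f) = s c (V f)) \<and> (\<forall>f. norm (V f) \<le> norm f)})"
      by (rule compact_Int_closed)
    then show ?thesis
      by (rule back_subst[of compact]) (auto simp: U_def)
  qed
  have closed: "closed (good f)" for f
    unfolding good_def
    by (intro closed_Collect_le continuous_on_norm continuous_on_diff cont_B continuous_on_const)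
  have fip: "U \<inter> \<Inter> (good ` F) \<noteq> {}" if F: "finite F" for F
  proof -
    obtain a where a0: "0 \<le> a" and a: "\<And>x. norm (A x) \<le> a * norm x"
      using A by (metis bop_bound)
    define m where "m = Min (insert 1 (norm ` (F - {0})))"
    have m: "0 < m" and m_le: "\<And>f. f \<in> F \<Longrightarrow> f \<noteq> 0 \<Longrightarrow> m \<le> norm f"
      using F by (auto simp: m_def)
    \<comment> \<open>Small enough to turn an absolute error into one relative to every nonzero element of \<open>F\<close>.\<close>
    define \<epsilon> where "\<epsilon> = 2 * \<delta> * m / (a + 1)"
    have "0 < \<epsilon>"
      using \<delta> m a0 by (simp add: \<epsilon>_def)
    then obtain d :: nat and \<phi> e where *: "\<forall>k x y. \<phi> k (x + y) = \<phi> k x + \<phi> k y"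
      "\<forall>k c x. \<phi> k (s c x) = c * \<phi> k x" "\<forall>x. (\<Sum>k<d. norm (\<phi> k x)) \<le> norm x"
      "\<forall>k. norm (e k) \<le> 1" "\<forall>x\<in>F. norm (x - (\<Sum>k<d. s (\<phi> k x) (e k))) \<le> \<epsilon>"
      using approx[unfolded ell1_approximable_def, rule_format, OF F] by blast
    note \<phi>_add = *(1)[rule_format] and \<phi>_scale = *(2)[rule_format] and \<phi>_le = *(3)[rule_format]
      and e = *(4)[rule_format] and close = *(5)[rule_format]
    obtain l where l: "\<And>k. l k \<in> Z" and Al: "\<And>k. norm (A (e k) - B (l k)) \<le> 2 * \<delta>"
      using Z_near[OF e] by metis
    define V where "V x = (\<Sum>k<d. s (\<phi> k x) (l k))" for x
    have "V f \<in> G f" for f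
    proof -
      define c where "c z = (\<Sum>k | k < d \<and> l k = z. \<phi> k f)" for z
      have "norm (c z) \<le> norm f" for z
      proof -
        have "norm (c z) \<le> (\<Sum>k | k < d \<and> l k = z. norm (\<phi> k f))"
          unfolding c_def by (rule norm_sum)
        also have "\<dots> \<le> (\<Sum>k<d. norm (\<phi> k f))"
          by (rule sum_mono2) auto
        finally show ?thesis
          using \<phi>_le order_trans by blast
      qed
      moreover have "V f = (\<Sum>z\<in>Z. s (c z) z)"
      proof -
        have "V f = (\<Sum>z\<in>Z. \<Sum>k | k \<in> {..<d} \<and> l k = z. s (\<phi> k f) (l k))"
          unfolding V_def by (rule sum.group[symmetric]) (use l Z in auto)
        also have "\<dots> = (\<Sum>z\<in>Z. s (c z) z)"
          by (intro sum.cong refl) (simp add: c_def scale_sum_left)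
        finally show ?thesis .
      qed
      ultimately show ?thesis
        by (auto simp: G_def)
    qed
    moreover have "V (f + g) = V f + V g" for f g
      by (simp add: V_def \<phi>_add scale_left_distrib sum.distrib)
    moreover have "V (s c f) = s c (V f)" for c f
      by (simp add: V_def \<phi>_scale scale_sum_right)
    moreover have "norm (V f) \<le> norm f" for f
    proof -
      have "norm (V f) \<le> (\<Sum>k<d. norm (\<phi> k f) * 1)"
        unfolding V_def using l Z_le
        by (intro sum_norm_le) (simp add: norm_scale mult_left_le)
      then show ?thesis
        using \<phi>_le[of f] by simp
    qed
    ultimately have VU: "V \<in> U"
      by (simp add: U_def)
    have "norm (A f - B (V f)) \<le> 4 * \<delta> * norm f" if f: "f \<in> F" for f
    proof (cases "f = 0")
      case True
      have "\<phi> k 0 = 0" for k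
        using \<phi>_add[of k 0 0] by simp
      then show ?thesis
        using True by (simp add: V_def bop_zero[OF A] bop_zero[OF B])
    next
      case False
      define E where "E = (\<Sum>k<d. s (\<phi> k f) (e k))"
      have "norm (A (f - E)) \<le> a * \<epsilon>"
        using close[OF f] a0 by (intro order_trans[OF a] mult_left_mono) (auto simp: E_def)
      also have "\<dots> \<le> (a + 1) * \<epsilon>"
        using \<open>0 < \<epsilon>\<close> by (intro mult_right_mono) auto
      also have "\<dots> = 2 * \<delta> * m"
        using a0 by (simp add: \<epsilon>_def)
      also have "\<dots> \<le> 2 * \<delta> * norm f"
        using m_le[OF f False] \<delta> by simp
      finally have 1: "norm (A f - A E) \<le> 2 * \<delta> * norm f"
        by (simp add: bop_diff[OF A])
      have "A E - B (V f) = (\<Sum>k<d. s (\<phi> k f) (A (e k) - B (l k)))"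
        by (simp add: E_def V_def bop_sum[OF A] bop_sum[OF B] bop_scale[OF A] bop_scale[OF B]
            scale_right_diff_distrib sum_subtractf)
      also have "norm \<dots> \<le> (\<Sum>k<d. norm (\<phi> k f) * (2 * \<delta>))"
        by (intro sum_norm_le) (simp only: norm_scale mult_left_mono[OF Al norm_ge_zero])
      also have "\<dots> \<le> norm f * (2 * \<delta>)"
        using \<phi>_le[of f] \<delta> by (simp add: sum_distrib_right[symmetric])
      finally show ?thesis
        using 1 norm_triangle_ineq[of "A f - A E" "A E - B (V f)"] by (simp add: algebra_simps)
    qed
    then show ?thesis
      using VU by (auto simp: good_def)
  qed
  have "U \<inter> \<Inter> (good ` UNIV) \<noteq> {}"
    by (rule compact_imp_fip_image[OF U closed fip])
  then obtain V where V: "V \<in> U" "\<And>f. V \<in> good f"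
    by blast
  then have "bop V" "\<And>x. norm (V x) \<le> norm x"
    by (auto simp: U_def intro!: bopI[where c = 1])
  then show ?thesis
    using that V(2) by (simp add: good_def)
qed

end

context sum_decomposition
begin

text \<open>
  Among the finitely many subsets of a finite net one recurs as the set of points close to the
  image of the unit ball of the \<open>j\<close>-th summand.
\<close>

lemma compact_columns_recur:
  assumes K: "bop K" and D: "compact D" and KD: "K ` cball 0 C \<subseteq> D" and \<delta>: "0 < \<delta>"
  shows "\<exists>i j. N \<le> i \<and> i < j \<and>
    (\<forall>x. norm x \<le> 1 \<longrightarrow> (\<exists>x'. norm x' \<le> 1 \<and> norm (K (ins i x) - K (ins j x')) \<le> \<delta>))"
proof -
  have "0 < \<delta> / 2"
    using \<delta> by simp
  then obtain Y where Y: "finite Y" "D \<subseteq> (\<Union>y\<in>Y. ball y (\<delta> / 2))"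
    using D unfolding compact_eq_totally_bounded by blast
  define hit where "hit j = {y\<in>Y. \<exists>x. norm x \<le> 1 \<and> norm (K (ins j x) - y) < \<delta> / 2}" for j
  have "hit ` {N..} \<subseteq> Pow Y"
    by (auto simp: hit_def)
  then have "finite (hit ` {N..})"
    by (rule finite_subset) (simp add: Y(1))
  then have "\<not> inj_on hit {N..}"
    by (auto dest: finite_imageD simp: infinite_Ici)
  then obtain i j where ij: "N \<le> i" "i < j" "hit i = hit j"
    unfolding inj_on_def by (metis atLeast_iff nat_neq_iff)
  have "\<exists>x'. norm x' \<le> 1 \<and> norm (K (ins i x) - K (ins j x')) \<le> \<delta>" if x: "norm x \<le> 1" for x
  proof -
    have "norm (ins i x) \<le> C"
      using mult_left_mono[OF x, of C] norm_ins_le[of i x] C_ge_1 by linarith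
    then obtain y where y: "y \<in> Y" "norm (K (ins i x) - y) < \<delta> / 2"
      using KD Y(2) by (fastforce simp: dist_norm norm_minus_commute)
    then have "y \<in> hit j"
      using x ij(3) by (auto simp: hit_def)
    then obtain x' where "norm x' \<le> 1" "norm (K (ins j x') - y) < \<delta> / 2"
      by (auto simp: hit_def)
    moreover have "norm (K (ins i x) - K (ins j x')) \<le> norm (K (ins i x) - y) + norm (K (ins j x') - y)"
      using norm_triangle_ineq4[of "K (ins i x) - y" "K (ins j x') - y"] by simp
    ultimately show ?thesis
      using y(2) by (intro exI[of _ x']) auto
  qed
  then show ?thesis
    using ij by blast
qed

text \<open>
  If the \<open>i\<close>-th column \<open>K \<iota>\<^sub>i\<close> is close to \<open>K \<iota>\<^sub>j V\<close>, then \<open>K\<close> is small on the vectors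
  \<open>\<iota>\<^sub>i x - \<iota>\<^sub>j V x\<close>. For infinitely many disjoint pairs \<open>(i, j)\<close> at once, the shear \<open>I - S\<close> that
  takes \<open>\<iota>\<^sub>i x\<close> to these vectors satisfies \<open>S\<^sup>2 = 0\<close> and is therefore invertible.
\<close>

lemma compact_columns_small_after_shear:
  assumes approx: "ell1_approximable s"
    and K: "bop K" and D: "compact D" and KD: "K ` cball 0 C \<subseteq> D"
  obtains S where "bop S" and "\<And>x. S (S x) = 0"
    and "\<And>\<epsilon> N. 0 < \<epsilon> \<Longrightarrow> \<exists>j\<ge>N. \<forall>x. norm (K (ins j x - S (ins j x))) \<le> \<epsilon> * norm x"
proof -
  define pair where "pair n t \<longleftrightarrow> (case t of (i, j, V) \<Rightarrow> i < j \<and> bop V \<and> (\<forall>x. norm (V x) \<le> norm x) \<and>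
    (\<forall>x. norm (K (ins i x) - K (ins j (V x))) \<le> 4 * (1 / 2) ^ n * norm x))" for n :: nat and t
  have ex: "\<exists>t. pair n t \<and> N \<le> fst t" for n N
  proof -
    obtain i j where ij: "N \<le> i" "i < j" and near: "\<And>x. norm x \<le> 1 \<Longrightarrow>
        \<exists>x'. norm x' \<le> 1 \<and> norm (K (ins i x) - K (ins j x')) \<le> (1 / 2) ^ n"
      using compact_columns_recur[OF K D KD, of "(1 / 2) ^ n" N] by auto
    have "(\<lambda>x. K (ins i x)) ` cball 0 1 \<subseteq> D"
    proof safe
      fix x :: 'a assume "x \<in> cball 0 1"
      then have "norm (ins i x) \<le> C * 1"
        using C_ge_1 by (intro order_trans[OF norm_ins_le] mult_left_mono) auto
      then show "K (ins i x) \<in> D"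
        using KD by auto
    qed
    then obtain V where "bop V" "\<And>x. norm (V x) \<le> norm x"
      "\<And>x. norm (K (ins i x) - K (ins j (V x))) \<le> 4 * (1 / 2) ^ n * norm x"
      using lift_compact_operator[OF approx bop_comp[OF K bop_ins[of i]] bop_comp[OF K bop_ins[of j]] D _ _ near]
      by (metis zero_less_divide_1_iff zero_less_numeral zero_less_power)
    then show ?thesis
      using ij by (intro exI[of _ "(i, j, V)"]) (simp add: pair_def)
  qed
  have "\<exists>t. \<forall>n. pair n (t n) \<and> fst (snd (t n)) < fst (t (Suc n))"
    using ex by (intro dependent_nat_choice) (metis Suc_le_lessD)+
  then obtain t where t: "\<And>n. pair n (t n)" and step: "\<And>n. fst (snd (t n)) < fst (t (Suc n))"
    by blast
  define i j V where "i n = fst (t n)" and "j n = fst (snd (t n))" and "V n = snd (snd (t n))" for n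
  have ij: "i n < j n" and V: "bop (V n)" and V_le: "norm (V n x) \<le> norm x"
    and KV: "norm (K (ins (i n) x) - K (ins (j n) (V n x))) \<le> 4 * (1 / 2) ^ n * norm x" for n x
    using t[of n] by (auto simp: pair_def i_def j_def V_def split: prod.splits)
  have ji: "j n < i (Suc n)" for n
    using step by (simp add: i_def j_def V_def)
  have mono_i: "strict_mono i" and mono_j: "strict_mono j"
    using ij ji by (auto intro!: strict_monoI_Suc intro: less_trans)
  have disj: "i m \<noteq> j n" for m n
  proof (cases "m \<le> n")
    case True
    then show ?thesis
      using ij[of n] mono_i by (metis not_le strict_mono_less_eq)
  next
    case False
    then have "i (Suc n) \<le> i m"
      using mono_i by (simp add: strict_mono_less_eq)
    then show ?thesis
      using ji[of n] by simp
  qed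
  have inj_j: "inj j"
    using mono_j by (rule strict_mono_imp_inj_on)
  define S where "S = reindex (range j) (\<lambda>k. V (inv j k)) (\<lambda>k. i (inv j k))"
  have inj: "inj_on (\<lambda>k. i (inv j k)) (range j)"
    using mono_i inj_j by (auto simp: inj_on_def strict_mono_eq)
  have V_le': "norm (V (inv j k) x) \<le> 1 * norm x" for k x
    using V_le by simp
  note S_facts = reindex[OF inj, where a = "\<lambda>k. V (inv j k)" and c = 1, OF V V_le' zero_le_one, folded S_def]
  have S: "bop S" and JS: "J (S x) k = (if k \<in> range j then V (inv j k) (J x (i (inv j k))) else 0)"
    for x k
    using S_facts(1,3) by auto
  have "S (S x) = 0" for x
  proof (rule coordinates_eqI)
    fix k
    show "J (S (S x)) k = J 0 k"
      using disj by (auto simp: JS J_zero bop_zero[OF V])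
  qed
  moreover have S_ins: "S (ins (i n) x) = ins (j n) (V n x)" for n x
  proof (rule coordinates_eqI)
    fix k
    show "J (S (ins (i n) x)) k = J (ins (j n) (V n x)) k"
      using inj_j mono_i
      by (cases "k \<in> range j") (auto simp: JS J_ins bop_zero[OF V] strict_mono_eq inj_eq)
  qed
  moreover have "\<exists>k\<ge>N. \<forall>x. norm (K (ins k x - S (ins k x))) \<le> \<epsilon> * norm x" if \<epsilon>: "0 < \<epsilon>" for \<epsilon> N
  proof -
    obtain n0 where n0: "(1 / 2) ^ n0 < \<epsilon> / 4"
      using \<epsilon> real_arch_pow_inv[of "\<epsilon> / 4" "1 / 2"] by auto
    define n where "n = max n0 N"
    have "(1 / 2 :: real) ^ n \<le> (1 / 2) ^ n0"
      by (rule power_decreasing) (auto simp: n_def)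
    then have "4 * (1 / 2) ^ n \<le> \<epsilon>"
      using n0 by linarith
    then have "4 * (1 / 2) ^ n * norm x \<le> \<epsilon> * norm x" for x :: 'a
      by (rule mult_right_mono) simp
    then have "norm (K (ins (i n) x - S (ins (i n) x))) \<le> \<epsilon> * norm x" for x
      using order_trans[OF KV[of n x]] by (simp add: S_ins bop_diff[OF K])
    moreover have "N \<le> i n"
      using seq_suble[OF mono_i, of n] by (simp add: n_def)
    ultimately show ?thesis
      by blast
  qed
  ultimately show ?thesis
    using that S by blast
qed

end


section \<open>$\ell_1$ and $L_1$ are approximable by finite-dimensional $\ell_1$-spaces\<close>

text \<open>In $\ell_1$ the partial sums of the expansion in unit vectors do it.\<close>

lemma ell1_approximable_seq_sum:
  fixes s :: "'k::{real_normed_field, euclidean_space} \<Rightarrow> 'a::banach \<Rightarrow> 'a"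
  assumes iso: "isometrically_isomorphic s (UNIV :: 'a set) norm
    (seq_scale (*)) (seq_sum 1 :: (nat \<Rightarrow> 'k) set) (seq_norm 1)"
  shows "ell1_approximable s"
proof -
  obtain J :: "'a \<Rightarrow> nat \<Rightarrow> 'k" where bij: "bij_betw J UNIV (seq_sum 1)"
    and "\<And>x y. J (x + y) = J x + J y" and "\<And>c x. J (s c x) = seq_scale (*) c (J x)"
    and J_norm: "\<And>x. seq_norm 1 (J x) = norm x"
    using iso by (auto simp: isometrically_isomorphic_def linear_bijection_def)
  then have J_add: "J (x + y) k = J x k + J y k" and J_scale: "J (s c x) k = c * J x k" for x y c k
    by (simp_all add: seq_scale_def)
  have J_mem: "J x \<in> seq_sum 1" for x
    using bij by (auto simp: bij_betw_def)
  define e where "e k = inv J (\<lambda>i. if i = k then 1 else 0)" for k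
  have unit_mem: "(\<lambda>i. if i = k then 1 else 0 :: 'k) \<in> seq_sum 1" for k :: nat
    by (rule finite_support_seq_sum[of "{k}"]) auto
  then have J_e: "J (e k) = (\<lambda>i. if i = k then 1 else 0)" for k
    unfolding e_def using bij by (intro bij_betw_inv_into_right)
  have J_diff: "J (x - y) k = J x k - J y k" for x y k
    using J_add[of "x - y" y k] by simp
  have J_sum: "J (\<Sum>i<d. g i) k = (\<Sum>i<d. J (g i) k)" for g and d k :: nat
    using J_diff[of 0 0 k] by (induction d) (simp_all add: J_add)
  show ?thesis
    unfolding ell1_approximable_def
  proof (intro allI impI)
    fix F :: "'a set" and \<epsilon> :: real
    assume F: "finite F" and \<epsilon>: "0 < \<epsilon>"
    have tail: "norm (x - (\<Sum>k<d. s (J x k) (e k))) = seq_norm 1 (\<lambda>i. if i < d then 0 else J x i)"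
      for x d
    proof -
      have "J (x - (\<Sum>k<d. s (J x k) (e k))) = (\<lambda>i. if i < d then 0 else J x i)"
        by (auto simp: fun_eq_iff J_diff J_sum J_scale J_e if_distrib cong: if_cong)
      then show ?thesis
        using J_norm[of "x - (\<Sum>k<d. s (J x k) (e k))"] by simp
    qed
    have "\<forall>\<^sub>F d in sequentially. norm (x - (\<Sum>k<d. s (J x k) (e k))) < \<epsilon>" for x
      unfolding tail
      using order_tendstoD(2)[OF seq_norm_tail_tendsto_0[OF _ J_mem] \<epsilon>] by simp
    then have "\<forall>\<^sub>F d in sequentially. \<forall>x\<in>F. norm (x - (\<Sum>k<d. s (J x k) (e k))) < \<epsilon>"
      using F by (simp add: eventually_ball_finite)
    then obtain d where d: "\<And>x. x \<in> F \<Longrightarrow> norm (x - (\<Sum>k<d. s (J x k) (e k))) < \<epsilon>"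
      unfolding eventually_sequentially by blast
    have norm_sum: "(\<Sum>k<d. norm (J x k)) \<le> norm x" for x
    proof -
      have sm: "summable (\<lambda>k. norm (J x k))"
        using J_mem[of x] by (simp add: seq_sum_def)
      have "(\<Sum>k<d. norm (J x k)) \<le> (\<Sum>k. norm (J x k))"
        by (intro sum_le_suminf[OF sm]) auto
      also have "\<dots> = seq_norm 1 (J x)"
        using suminf_nonneg[OF sm] by (simp add: seq_norm_def)
      finally show ?thesis
        by (simp add: J_norm)
    qed
    have norm_e: "norm (e k) \<le> 1" for k
    proof -
      have "seq_norm 1 (J (e k)) \<le> 1"
        using seq_norm_finite_support_le[of 1 "{k}" "J (e k)" 1] by (simp add: J_e)
      then show ?thesis
        by (simp add: J_norm)
    qed
    show "\<exists>(d::nat) \<phi> e. (\<forall>k x y. \<phi> k (x + y) = \<phi> k x + \<phi> k y) \<and> (\<forall>k c x. \<phi> k (s c x) = c * \<phi> k x) \<and>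
        (\<forall>x. (\<Sum>k<d. norm (\<phi> k x)) \<le> norm x) \<and> (\<forall>k. norm (e k) \<le> 1) \<and>
        (\<forall>x\<in>F. norm (x - (\<Sum>k<d. s (\<phi> k x) (e k))) \<le> \<epsilon>)"
      by (intro exI[of _ d] exI[of _ "\<lambda>k x. J x k"] exI[of _ e])
        (auto simp: J_add J_scale norm_sum norm_e intro!: less_imp_le[OF d])
  qed
qed

lemma ell1_approximable_isometric:
  fixes s :: "'k::{real_normed_field, euclidean_space} \<Rightarrow> 'a::real_normed_vector \<Rightarrow> 'a"
    and t :: "'k \<Rightarrow> 'b::real_normed_vector \<Rightarrow> 'b"
  assumes iso: "isometrically_isomorphic s (UNIV :: 'a set) norm t (UNIV :: 'b set) norm"
    and approx: "ell1_approximable t"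
  shows "ell1_approximable s"
proof -
  obtain J :: "'a \<Rightarrow> 'b" where bij: "bij J" and J_add: "\<And>x y. J (x + y) = J x + J y"
    and J_scale: "\<And>c x. J (s c x) = t c (J x)" and J_norm: "\<And>x. norm (J x) = norm x"
    using iso by (auto simp: isometrically_isomorphic_def linear_bijection_def)
  have J_inv: "J (inv J y) = y" for y
    using bij by (simp add: bij_is_surj surj_f_inv_f)
  have J_diff: "J (x - y) = J x - J y" for x y
    using J_add[of "x - y" y] by simp
  have J_sum: "J (\<Sum>i<d. g i) = (\<Sum>i<d. J (g i))" for g and d :: nat
    using J_diff[of 0 0] by (induction d) (simp_all add: J_add)
  show ?thesis
    unfolding ell1_approximable_def
  proof (intro allI impI)
    fix F :: "'a set" and \<epsilon> :: real
    assume F: "finite F" and \<epsilon>: "0 < \<epsilon>"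
    define JF where "JF = J ` F"
    have JF: "finite JF"
      using F by (simp add: JF_def)
    obtain d :: nat and \<phi> e where *: "\<forall>k x y. \<phi> k (x + y) = \<phi> k x + \<phi> k y"
      "\<forall>k c x. \<phi> k (t c x) = c * \<phi> k x" "\<forall>x. (\<Sum>k<d. norm (\<phi> k x)) \<le> norm x"
      "\<forall>k. norm (e k) \<le> 1" "\<forall>x\<in>JF. norm (x - (\<Sum>k<d. t (\<phi> k x) (e k))) \<le> \<epsilon>"
      using approx[unfolded ell1_approximable_def, rule_format, OF JF \<epsilon>] by blast
    have norm_sum: "(\<Sum>k<d. norm (\<phi> k (J x))) \<le> norm x" for x
      using *(3) J_norm by metis
    have norm_e: "norm (inv J (e k)) \<le> 1" for k
      using *(4)[rule_format, of k] J_norm[of "inv J (e k)"] by (simp add: J_inv)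
    have close: "norm (x - (\<Sum>k<d. s (\<phi> k (J x)) (inv J (e k)))) \<le> \<epsilon>" if "x \<in> F" for x
    proof -
      have "J (x - (\<Sum>k<d. s (\<phi> k (J x)) (inv J (e k)))) = J x - (\<Sum>k<d. t (\<phi> k (J x)) (e k))"
        by (simp add: J_diff J_sum J_scale J_inv)
      then show ?thesis
        using *(5)[rule_format, of "J x"] that J_norm[of "x - (\<Sum>k<d. s (\<phi> k (J x)) (inv J (e k)))"]
        by (simp add: JF_def)
    qed
    show "\<exists>(d::nat) \<phi> e. (\<forall>k x y. \<phi> k (x + y) = \<phi> k x + \<phi> k y) \<and> (\<forall>k c x. \<phi> k (s c x) = c * \<phi> k x) \<and>
        (\<forall>x. (\<Sum>k<d. norm (\<phi> k x)) \<le> norm x) \<and> (\<forall>k. norm (e k) \<le> 1) \<and>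
        (\<forall>x\<in>F. norm (x - (\<Sum>k<d. s (\<phi> k x) (e k))) \<le> \<epsilon>)"
      by (intro exI[of _ d] exI[of _ "\<lambda>k x. \<phi> k (J x)"] exI[of _ "\<lambda>k. inv J (e k)"])
        (intro conjI allI ballI; simp only: *(1,2)[rule_format] J_add J_scale norm_sum norm_e close)
  qed
qed

lemma normed_scaling_L1: "normed_scaling (L1_scale :: 'k::{real_normed_field, euclidean_space} \<Rightarrow> 'k L1 \<Rightarrow> 'k L1)"
  unfolding normed_scaling_def
proof (intro conjI allI)
  show "vector_space (L1_scale :: 'k \<Rightarrow> 'k L1 \<Rightarrow> 'k L1)"
    by unfold_locales (transfer; auto simp: L1_eq_def algebra_simps)+
  show "norm (L1_scale c f) = norm c * norm f" for c and f :: "'k L1"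
    by transfer (simp add: norm_mult)
  show "L1_scale (of_real r) f = r *\<^sub>R f" for r and f :: "'k L1"
    by transfer (auto simp: L1_eq_def scaleR_conv_of_real)
qed

text \<open>
  The default value on sets that are not measurable keeps all functions involved measurable, so
  that both definitions below respect equality almost everywhere.
\<close>

lift_definition L1_integral :: "real set \<Rightarrow> 'k L1 \<Rightarrow> 'k::{real_normed_field, euclidean_space}" is
  "\<lambda>A f. if A \<in> sets unit_measure then \<integral>x. indicat_real A x *\<^sub>R f x \<partial>unit_measure else 0"
  by (auto simp: L1_eq_def intro!: integral_cong_AE)

lemma finite_emeasure_unit: "emeasure unit_measure A < \<infinity>"
  using finite_measure.emeasure_finite[OF finite_measure_lebesgue_on[of "{0..1::real}"], of A]
  by (simp add: less_top)

lemma has_bochner_integral_of_real_indicator: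
  assumes "A \<in> sets unit_measure"
  shows "has_bochner_integral unit_measure
    (\<lambda>x. of_real (indicat_real A x) :: 'k::{real_normed_field, euclidean_space})
    (of_real (measure unit_measure A))"
  using has_bochner_integral_indicator[OF assms finite_emeasure_unit, of "1 :: 'k"]
  by (simp add: scaleR_conv_of_real)

lemma integrable_of_real_indicator:
  "A \<in> sets unit_measure \<Longrightarrow>
   integrable unit_measure (\<lambda>x. of_real (indicat_real A x) :: 'k::{real_normed_field, euclidean_space})"
  using has_bochner_integral_of_real_indicator by (auto simp: has_bochner_integral_iff)

lift_definition L1_indicator :: "real set \<Rightarrow> 'k::{real_normed_field, euclidean_space} L1" is
  "\<lambda>A x. if A \<in> sets unit_measure then of_real (indicat_real A x) else 0"
proof -
  fix A :: "real set"
  show "L1_eq (\<lambda>x. if A \<in> sets unit_measure then of_real (indicat_real A x) else 0 :: 'k)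
      (\<lambda>x. if A \<in> sets unit_measure then of_real (indicat_real A x) else 0)"
    by (cases "A \<in> sets unit_measure") (simp_all add: L1_eq_def integrable_of_real_indicator)
qed

lemma L1_integral_add: "L1_integral A (f + g) = L1_integral A f + L1_integral A g"
  by transfer (auto simp: L1_eq_def scaleR_add_right intro!: Bochner_Integration.integral_add integrable_mult_indicator)

lemma L1_integral_scale: "L1_integral A (L1_scale c f) = c * L1_integral A f"
proof transfer
  fix A and c :: 'a and f :: "real \<Rightarrow> 'a"
  show "(if A \<in> sets unit_measure then \<integral>x. indicat_real A x *\<^sub>R (c * f x) \<partial>unit_measure else 0)
      = c * (if A \<in> sets unit_measure then \<integral>x. indicat_real A x *\<^sub>R f x \<partial>unit_measure else 0)"
    using integral_mult_right_zero[of unit_measure c "\<lambda>x. indicat_real A x *\<^sub>R f x"] by simp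
qed

lemma norm_L1_indicator: "A \<in> sets unit_measure \<Longrightarrow> norm (L1_indicator A) = measure unit_measure A"
proof transfer
  fix A :: "real set" assume A: "A \<in> sets unit_measure"
  then have "A \<inter> {0..1} = A"
    using sets.sets_into_space[OF A] by auto
  then show "(\<integral>x. norm (if A \<in> sets unit_measure then of_real (indicat_real A x) else 0 :: 'a) \<partial>unit_measure)
      = measure unit_measure A"
    using A by simp
qed

lemma L1_integral_indicator:
  "A \<in> sets unit_measure \<Longrightarrow> B \<in> sets unit_measure \<Longrightarrow>
   L1_integral A (L1_indicator B) = of_real (measure unit_measure (A \<inter> B))"
proof transfer
  fix A B :: "real set"
  assume A: "A \<in> sets unit_measure" and B: "B \<in> sets unit_measure"
  have "(\<integral>x. indicat_real A x *\<^sub>R (of_real (indicat_real B x) :: 'a) \<partial>unit_measure)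
      = (\<integral>x. of_real (indicat_real (A \<inter> B) x) \<partial>unit_measure)"
    by (intro Bochner_Integration.integral_cong refl) (simp add: indicator_def)
  also have "\<dots> = of_real (measure unit_measure (A \<inter> B))"
    using has_bochner_integral_of_real_indicator[of "A \<inter> B", where 'k = 'a] A B
    by (simp add: has_bochner_integral_iff)
  finally show "(if A \<in> sets unit_measure then \<integral>x. indicat_real A x *\<^sub>R
      (if B \<in> sets unit_measure then of_real (indicat_real B x) else 0 :: 'a) \<partial>unit_measure else 0)
      = of_real (measure unit_measure (A \<inter> B))"
    using A B by simp
qed

lemma sum_norm_L1_integral_le:
  fixes f :: "'k::{real_normed_field, euclidean_space} L1"
  assumes "finite I" and "\<And>i. i \<in> I \<Longrightarrow> A i \<in> sets unit_measure" and "disjoint_family_on A I"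
  shows "(\<Sum>i\<in>I. norm (L1_integral (A i) f)) \<le> norm f"
  using assms
proof transfer
  fix I :: "'b set" and A :: "'b \<Rightarrow> real set" and f :: "real \<Rightarrow> 'k"
  assume f: "L1_eq f f" and I: "finite I" and A: "\<And>i. i \<in> I \<Longrightarrow> A i \<in> sets unit_measure"
    and disj: "disjoint_family_on A I"
  have fi: "integrable unit_measure f"
    using f by (simp add: L1_eq_def)
  have int: "integrable unit_measure (\<lambda>x. indicat_real (A i) x *\<^sub>R f x)" if "i \<in> I" for i
    using A[OF that] fi by (rule integrable_mult_indicator)
  have "(\<Sum>i\<in>I. norm (if A i \<in> sets unit_measure then \<integral>x. indicat_real (A i) x *\<^sub>R f x \<partial>unit_measure else 0))
      \<le> (\<Sum>i\<in>I. \<integral>x. norm (indicat_real (A i) x *\<^sub>R f x) \<partial>unit_measure)"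
  proof (intro sum_mono)
    show "norm (if A i \<in> sets unit_measure then \<integral>x. indicat_real (A i) x *\<^sub>R f x \<partial>unit_measure else 0)
        \<le> (\<integral>x. norm (indicat_real (A i) x *\<^sub>R f x) \<partial>unit_measure)" if "i \<in> I" for i
      using A[OF that] integral_norm_bound[of unit_measure "\<lambda>x. indicat_real (A i) x *\<^sub>R f x"]
      by simp
  qed
  also have "\<dots> = (\<integral>x. (\<Sum>i\<in>I. norm (indicat_real (A i) x *\<^sub>R f x)) \<partial>unit_measure)"
    by (rule Bochner_Integration.integral_sum[symmetric]) (rule integrable_norm[OF int])
  also have "\<dots> \<le> (\<integral>x. norm (f x) \<partial>unit_measure)"
  proof (rule integral_mono)
    show "integrable unit_measure (\<lambda>x. \<Sum>i\<in>I. norm (indicat_real (A i) x *\<^sub>R f x))"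
    proof (rule Bochner_Integration.integrable_sum)
      show "integrable unit_measure (\<lambda>x. norm (indicat_real (A i) x *\<^sub>R f x))" if "i \<in> I" for i
        using int[OF that] by (rule integrable_norm)
    qed
    show "integrable unit_measure (\<lambda>x. norm (f x))"
      using fi by (rule integrable_norm)
    fix x
    have "(\<Sum>i\<in>I. norm (indicat_real (A i) x *\<^sub>R f x)) = (\<Sum>i\<in>I. indicator (A i) x) * norm (f x)"
      by (simp add: sum_distrib_right)
    also have "(\<Sum>i\<in>I. indicator (A i) x) = (indicator (\<Union>i\<in>I. A i) x :: real)"
      using indicator_UN_disjoint[OF I disj] by metis
    also have "\<dots> * norm (f x) \<le> norm (f x)"
      by (simp add: indicator_def)
    finally show "(\<Sum>i\<in>I. norm (indicat_real (A i) x *\<^sub>R f x)) \<le> norm (f x)" .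
  qed
  finally show "(\<Sum>i\<in>I. norm (if A i \<in> sets unit_measure then \<integral>x. indicat_real (A i) x *\<^sub>R f x \<partial>unit_measure else 0))
      \<le> (\<integral>x. norm (f x) \<partial>unit_measure)" .
qed

lemma abs_L1_eqI: "L1_eq f g \<Longrightarrow> abs_L1 f = abs_L1 g"
  by (rule Quotient3_rel_abs[OF Quotient3_L1])

lemma L1_eqI:
  assumes "integrable unit_measure f" and "\<And>x. x \<in> {0..1} \<Longrightarrow> f x = g x"
  shows "L1_eq f g"
proof -
  have "integrable unit_measure f = integrable unit_measure g"
    using assms(2) by (intro Bochner_Integration.integrable_cong) auto
  moreover have "AE x in unit_measure. f x = g x"
    using assms(2) by (intro AE_I2) simp
  ultimately show ?thesis
    using assms(1) by (simp add: L1_eq_def)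
qed

lemma abs_L1_sum:
  assumes "finite I" and "\<And>i. i \<in> I \<Longrightarrow> integrable unit_measure (f i)"
  shows "abs_L1 (\<lambda>x. \<Sum>i\<in>I. f i x) = (\<Sum>i\<in>I. abs_L1 (f i))"
  using assms
proof (induction I)
  case (insert i I)
  then have "L1_eq (f i) (f i)" "L1_eq (\<lambda>x. \<Sum>i\<in>I. f i x) (\<lambda>x. \<Sum>i\<in>I. f i x)"
    by (auto simp: L1_eq_def)
  then show ?case
    using insert by (simp add: plus_L1.abs_eq[symmetric])
qed (simp add: zero_L1_def)

lemma L1_indicator_simple_dense:
  fixes f :: "'k::{real_normed_field, euclidean_space} L1"
  assumes "0 < \<epsilon>"
  shows "\<exists>Y A. finite Y \<and> (\<forall>y\<in>Y. A y \<in> sets unit_measure) \<and>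
    norm (f - (\<Sum>y\<in>Y. L1_scale y (L1_indicator (A y)))) < \<epsilon>"
proof (induction f rule: L1.abs_induct)
  case (1 f)
  then have f: "integrable unit_measure f"
    by (simp add: L1_eq_def)
  then obtain u where "has_bochner_integral unit_measure f u"
    using has_bochner_integral_integrable by blast
  then obtain g where g: "\<And>i. Bochner_Integration.simple_bochner_integrable unit_measure (g i)"
    and lim: "(\<lambda>i. \<integral>\<^sup>+x. norm (f x - g i x) \<partial>unit_measure) \<longlonglongrightarrow> 0"
    by (rule has_bochner_integral.cases) blast
  have "\<forall>\<^sub>F i in sequentially. (\<integral>\<^sup>+x. norm (f x - g i x) \<partial>unit_measure) < ennreal \<epsilon>"
    using assms by (intro order_tendstoD(2)[OF lim]) simp
  then obtain i where i: "(\<integral>\<^sup>+x. norm (f x - g i x) \<partial>unit_measure) < ennreal \<epsilon>"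
    unfolding eventually_sequentially by blast
  define h where "h = g i"
  have h: "simple_function unit_measure h" "integrable unit_measure h"
    using g[of i] has_bochner_integral_simple_bochner_integrable[OF g]
    by (auto simp: h_def Bochner_Integration.simple_bochner_integrable.simps has_bochner_integral_iff)
  have dist: "(\<integral>x. norm (f x - h x) \<partial>unit_measure) < \<epsilon>"
  proof -
    have "ennreal (\<integral>x. norm (f x - h x) \<partial>unit_measure) < ennreal \<epsilon>"
      using i f h(2) by (subst nn_integral_eq_integral[symmetric]) (auto simp: h_def)
    then show ?thesis
      using assms by (simp add: ennreal_less_iff)
  qed
  define Y where "Y = h ` {0..1}"
  define A where "A y = h -` {y} \<inter> {0..1}" for y
  have Y: "finite Y" and A: "A y \<in> sets unit_measure" for y
    using h(1) simple_functionD(2)[OF h(1), of "{y}"]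
    by (auto simp: Y_def A_def simple_function_def space_restrict_space)
  have int: "integrable unit_measure (\<lambda>x. y * of_real (indicat_real (A y) x))" for y
    by (intro integrable_mult_right integrable_of_real_indicator A)
  have "L1_scale y (L1_indicator (A y)) = abs_L1 (\<lambda>x. y * of_real (indicat_real (A y) x))" for y
    using integrable_of_real_indicator[OF A[of y], where 'k = 'k] A[of y]
    by (simp add: L1_indicator.abs_eq L1_indicator_def L1_scale.abs_eq L1_eq_def)
  then have "(\<Sum>y\<in>Y. L1_scale y (L1_indicator (A y)))
      = abs_L1 (\<lambda>x. \<Sum>y\<in>Y. y * of_real (indicat_real (A y) x))"
    using abs_L1_sum[OF Y int] by simp
  also have "\<dots> = abs_L1 h"
  proof (rule abs_L1_eqI, rule L1_eqI)
    show "integrable unit_measure (\<lambda>x. \<Sum>y\<in>Y. y * of_real (indicat_real (A y) x))"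
      using int by (intro Bochner_Integration.integrable_sum)
    fix x :: real assume x: "x \<in> {0..1}"
    have "(\<Sum>y\<in>Y. y * of_real (indicat_real (A y) x)) = (\<Sum>y\<in>Y. if h x = y then y else 0)"
      using x by (intro sum.cong) (auto simp: A_def)
    also have "\<dots> = h x"
      using Y x by (simp add: Y_def)
    finally show "(\<Sum>y\<in>Y. y * of_real (indicat_real (A y) x)) = h x" .
  qed
  finally have "norm (abs_L1 f - (\<Sum>y\<in>Y. L1_scale y (L1_indicator (A y))))
      = (\<integral>x. norm (f x - h x) \<partial>unit_measure)"
    using f h(2) by (simp add: minus_L1.abs_eq norm_L1.abs_eq L1_eq_def)
  then show ?case
    using Y A dist by metis
qed

text \<open>
  Up to a small error the given functions are constant on the atoms of a finite algebra of sets,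
  and the conditional expectation onto that algebra fixes such functions.
\<close>

lemma ell1_approximable_L1:
  "ell1_approximable (L1_scale :: 'k::{real_normed_field, euclidean_space} \<Rightarrow> 'k L1 \<Rightarrow> 'k L1)"
  unfolding ell1_approximable_def
proof (intro allI impI)
  fix F :: "'k L1 set" and \<epsilon> :: real
  assume F: "finite F" and \<epsilon>: "0 < \<epsilon>"
  interpret vector_space "L1_scale :: 'k \<Rightarrow> 'k L1 \<Rightarrow> 'k L1"
    using normed_scaling_L1[where 'k = 'k] by (simp add: normed_scaling_def)
  have norm_scale: "norm (L1_scale c f) = norm c * norm f"
    and scale_real: "L1_scale (of_real r) f = r *\<^sub>R f" for c r and f :: "'k L1"
    using normed_scaling_L1[where 'k = 'k] by (auto simp: normed_scaling_def)
  have "\<forall>f. \<exists>Y A. finite Y \<and> (\<forall>y\<in>Y. A y \<in> sets unit_measure) \<and>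
      norm (f - (\<Sum>y\<in>Y. L1_scale y (L1_indicator (A y)))) < \<epsilon> / 2" for f :: "'k L1"
    using \<epsilon> by (intro allI L1_indicator_simple_dense) simp
  then obtain Y A where Y: "\<And>f::'k L1. finite (Y f)" and A: "\<And>f y. y \<in> Y f \<Longrightarrow> A f y \<in> sets unit_measure"
    and simple: "\<And>f. norm (f - (\<Sum>y\<in>Y f. L1_scale y (L1_indicator (A f y)))) < \<epsilon> / 2"
    by metis
  define \<B> where "\<B> = (\<Union>f\<in>F. A f ` Y f)"
  have \<B>: "finite \<B>" and \<B>_sets: "\<And>B. B \<in> \<B> \<Longrightarrow> B \<in> sets unit_measure"
    using F Y A by (auto simp: \<B>_def)
  define atom where "atom S = {x \<in> {0..1}. \<forall>B\<in>\<B>. x \<in> B \<longleftrightarrow> B \<in> S}" for S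
  have atom_sets: "atom S \<in> sets unit_measure" for S
  proof -
    have "{x \<in> space unit_measure. x \<in> B \<longleftrightarrow> B \<in> S} \<in> sets unit_measure" if "B \<in> \<B>" for B
    proof (cases "B \<in> S")
      case True
      have "{x \<in> space unit_measure. x \<in> B \<longleftrightarrow> B \<in> S} = B"
        using True sets.sets_into_space[OF \<B>_sets[OF that]] by auto
      then show ?thesis
        using \<B>_sets[OF that] by simp
    next
      case False
      have "{x \<in> space unit_measure. x \<in> B \<longleftrightarrow> B \<in> S} = space unit_measure - B"
        using False by auto
      then show ?thesis
        using sets.compl_sets[OF \<B>_sets[OF that]] by argo
    qed
    then have "{x \<in> space unit_measure. \<forall>B\<in>\<B>. x \<in> B \<longleftrightarrow> B \<in> S} \<in> sets unit_measure"
      using \<B> by (intro sets.sets_Collect_finite_All)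
    then show ?thesis
      by (simp add: atom_def space_restrict_space)
  qed
  have disj: "disjoint_family_on atom (Pow \<B>)"
    by (fastforce simp: disjoint_family_on_def atom_def)
  define I where "I = Pow \<B>"
  have I: "finite I"
    using \<B> by (simp add: I_def)
  define e :: "real set set \<Rightarrow> 'k L1"
    where "e S = inverse (measure unit_measure (atom S)) *\<^sub>R L1_indicator (atom S)" for S
  have e_le: "norm (e S) \<le> 1" for S
    by (cases "measure unit_measure (atom S) = 0") (simp_all add: e_def norm_L1_indicator[OF atom_sets])
  have measure_e: "measure unit_measure (atom S) *\<^sub>R e S = L1_indicator (atom S)" for S
  proof (cases "measure unit_measure (atom S) = 0")
    case True
    then have "norm (L1_indicator (atom S) :: 'k L1) = 0"
      by (simp add: norm_L1_indicator[OF atom_sets])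
    then show ?thesis
      using True by simp
  qed (simp add: e_def)
  define E where "E f = (\<Sum>S\<in>I. L1_scale (L1_integral (atom S) f) (e S))" for f
  have E_add: "E (f + g) = E f + E g" for f g
    by (simp add: E_def L1_integral_add scale_left_distrib sum.distrib)
  have E_scale: "E (L1_scale c f) = L1_scale c (E f)" for c f
    by (simp add: E_def L1_integral_scale scale_sum_right)
  have E_sum: "E (sum g M) = (\<Sum>m\<in>M. E (g m))" for g and M :: "'k set"
    using E_scale[of 0 0] by (induction M rule: infinite_finite_induct) (simp_all add: E_add)
  have E_sum': "E (sum g M) = (\<Sum>m\<in>M. E (g m))" for g and M :: "real set set set"
    using E_scale[of 0 0] by (induction M rule: infinite_finite_induct) (simp_all add: E_add)
  have norm_sum: "(\<Sum>S\<in>I. norm (L1_integral (atom S) f)) \<le> norm f" for f :: "'k L1"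
    using I atom_sets disj by (intro sum_norm_L1_integral_le) (auto simp: I_def)
  have E_le: "norm (E f) \<le> norm f" for f
  proof -
    have "norm (E f) \<le> (\<Sum>S\<in>I. norm (L1_integral (atom S) f))"
      unfolding E_def using e_le by (intro sum_norm_le) (simp add: norm_scale mult_left_le)
    then show ?thesis
      using norm_sum order_trans by blast
  qed
  have E_atom: "E (L1_indicator (atom S)) = L1_indicator (atom S)" if S: "S \<in> I" for S
  proof -
    have "L1_scale (L1_integral (atom S') (L1_indicator (atom S))) (e S')
        = (if S' = S then L1_indicator (atom S) else 0)" if "S' \<in> I" for S'
    proof (cases "S' = S")
      case False
      then have "atom S' \<inter> atom S = {}"
        using disj S that by (auto simp: disjoint_family_on_def I_def)
      then show ?thesis
        using False by (simp add: L1_integral_indicator[OF atom_sets atom_sets])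
    qed (simp add: L1_integral_indicator[OF atom_sets atom_sets] scale_real measure_e)
    then show ?thesis
      using I S by (simp add: E_def)
  qed
  have indicator_eq: "L1_indicator B = (\<Sum>S\<in>{S\<in>I. B \<in> S}. L1_indicator (atom S) :: 'k L1)" if B: "B \<in> \<B>" for B
  proof -
    have "(L1_indicator B :: 'k L1) = abs_L1 (\<lambda>x. of_real (indicat_real B x))"
      using \<B>_sets[OF B] by (simp add: L1_indicator_def)
    also have "\<dots> = abs_L1 (\<lambda>x. \<Sum>S\<in>{S\<in>I. B \<in> S}. of_real (indicat_real (atom S) x))"
    proof (rule abs_L1_eqI, rule L1_eqI)
      show "integrable unit_measure (\<lambda>x. of_real (indicat_real B x) :: 'k)"
        by (rule integrable_of_real_indicator[OF \<B>_sets[OF B]])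
      fix x :: real assume x: "x \<in> {0..1}"
      define S where "S = {B\<in>\<B>. x \<in> B}"
      have "(\<Sum>S'\<in>{S\<in>I. B \<in> S}. of_real (indicat_real (atom S') x) :: 'k)
          = (\<Sum>S'\<in>{S\<in>I. B \<in> S}. if S' = S then 1 else 0)"
      proof (intro sum.cong refl)
        fix S' assume "S' \<in> {S\<in>I. B \<in> S}"
        then have "x \<in> atom S' \<longleftrightarrow> S' = S"
          using x by (auto simp: atom_def S_def I_def)
        then show "(of_real (indicat_real (atom S') x) :: 'k) = (if S' = S then 1 else 0)"
          by (auto simp: indicator_def)
      qed
      also have "\<dots> = (if x \<in> B then 1 else 0)"
        using I B by (auto simp: I_def S_def)
      finally show "(of_real (indicat_real B x) :: 'k) = (\<Sum>S\<in>{S\<in>I. B \<in> S}. of_real (indicat_real (atom S) x))"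
        by simp
    qed
    also have "\<dots> = (\<Sum>S\<in>{S\<in>I. B \<in> S}. abs_L1 (\<lambda>x. of_real (indicat_real (atom S) x)))"
      using I by (intro abs_L1_sum integrable_of_real_indicator atom_sets) auto
    also have "\<dots> = (\<Sum>S\<in>{S\<in>I. B \<in> S}. L1_indicator (atom S))"
      using atom_sets by (simp add: L1_indicator_def)
    finally show ?thesis .
  qed
  have E_indicator: "E (L1_indicator B) = L1_indicator B" if "B \<in> \<B>" for B
    by (simp add: indicator_eq[OF that] E_sum' E_atom)
  have close: "norm (f - E f) \<le> \<epsilon>" if f: "f \<in> F" for f
  proof -
    define g where "g = (\<Sum>y\<in>Y f. L1_scale y (L1_indicator (A f y)))"
    have "E g = g"
      unfolding g_def E_sum E_scale
    proof (rule sum.cong[OF refl])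
      fix y assume "y \<in> Y f"
      then have "A f y \<in> \<B>"
        using f unfolding \<B>_def by blast
      then show "L1_scale y (E (L1_indicator (A f y))) = L1_scale y (L1_indicator (A f y))"
        by (simp only: E_indicator)
    qed
    moreover have "E f = E g + E (f - g)"
      using E_add[of g "f - g"] by simp
    ultimately have "f - E f = (f - g) - E (f - g)"
      by simp
    then have "norm (f - E f) \<le> norm (f - g) + norm (E (f - g))"
      using norm_triangle_ineq4 by metis
    then show ?thesis
      using simple[of f] E_le[of "f - g"] by (simp add: g_def)
  qed
  obtain h where h: "bij_betw h {..<card I} I"
    using ex_bij_betw_nat_finite[OF I] by (auto simp: lessThan_atLeast0)
  have reindex: "(\<Sum>k<card I. q (h k)) = (\<Sum>S\<in>I. q S)" for q :: "real set set \<Rightarrow> 'k L1"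
    by (rule sum.reindex_bij_betw[OF h])
  have reindex': "(\<Sum>k<card I. q (h k)) = (\<Sum>S\<in>I. q S)" for q :: "real set set \<Rightarrow> real"
    by (rule sum.reindex_bij_betw[OF h])
  show "\<exists>(d::nat) \<phi> e. (\<forall>k f g. \<phi> k (f + g) = \<phi> k f + \<phi> k g) \<and> (\<forall>k c f. \<phi> k (L1_scale c f) = c * \<phi> k f) \<and>
      (\<forall>f. (\<Sum>k<d. norm (\<phi> k f)) \<le> norm f) \<and> (\<forall>k. norm (e k) \<le> 1) \<and>
      (\<forall>f\<in>F. norm (f - (\<Sum>k<d. L1_scale (\<phi> k f) (e k))) \<le> \<epsilon>)"
  proof (intro exI conjI allI ballI)
    show "L1_integral (atom (h k)) (f + g) = L1_integral (atom (h k)) f + L1_integral (atom (h k)) g"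
      and "L1_integral (atom (h k)) (L1_scale c f) = c * L1_integral (atom (h k)) f" for k f g c
      by (rule L1_integral_add, rule L1_integral_scale)
    show "(\<Sum>k<card I. norm (L1_integral (atom (h k)) f)) \<le> norm f" for f :: "'k L1"
      using norm_sum by (simp only: reindex'[of "\<lambda>S. norm (L1_integral (atom S) f)"])
    show "norm (e (h k)) \<le> 1" for k
      by (rule e_le)
    show "norm (f - (\<Sum>k<card I. L1_scale (L1_integral (atom (h k)) f) (e (h k)))) \<le> \<epsilon>" if "f \<in> F" for f
      using close[OF that] by (simp only: reindex[of "\<lambda>S. L1_scale (L1_integral (atom S) f) (e S)"] E_def)
  qed
qed


section \<open>Operators that are compact on a large complemented subspace\<close>

lemma linearly_homeomorphic_sym:
  assumes iso: "linearly_homeomorphic s S N s' S' N'"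
    and add: "\<And>x y. x \<in> S \<Longrightarrow> y \<in> S \<Longrightarrow> x + y \<in> S" and scale: "\<And>c x. x \<in> S \<Longrightarrow> s c x \<in> S"
  shows "linearly_homeomorphic s' S' N' s S N"
proof -
  obtain J C where lin: "linear_bijection s S s' S' J"
    and bd: "\<forall>x\<in>S. N' (J x) \<le> C * N x \<and> N x \<le> C * N' (J x)"
    using iso unfolding linearly_homeomorphic_def by blast
  have bij: "bij_betw J S S'" and J_add: "\<And>x y. x \<in> S \<Longrightarrow> y \<in> S \<Longrightarrow> J (x + y) = J x + J y"
    and J_scale: "\<And>c x. x \<in> S \<Longrightarrow> J (s c x) = s' c (J x)"
    using lin by (auto simp: linear_bijection_def)
  define G where "G = inv_into S J"
  have G: "G y \<in> S" "J (G y) = y" if "y \<in> S'" for y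
    using bij that by (auto simp: G_def bij_betw_inv_into_right inv_into_into bij_betw_def)
  have GJ: "G (J x) = x" if "x \<in> S" for x
    using bij that by (simp add: G_def bij_betw_inv_into_left)
  have "G (x + y) = G x + G y" if "x \<in> S'" "y \<in> S'" for x y
    using GJ[OF add[OF G(1) G(1)]] G that by (simp add: J_add)
  moreover have "G (s' c x) = s c (G x)" if "x \<in> S'" for c x
    using GJ[OF scale[OF G(1)]] G that by (simp add: J_scale)
  moreover have "bij_betw G S' S"
    unfolding G_def by (rule bij_betw_inv_into[OF bij])
  ultimately have "linear_bijection s' S' s S G"
    by (simp add: linear_bijection_def)
  moreover have "\<forall>y\<in>S'. N (G y) \<le> C * N' y \<and> N' y \<le> C * N (G y)"
    using bd G by metis
  ultimately show ?thesis
    unfolding linearly_homeomorphic_def by blast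
qed

context scaled_space
begin

text \<open>
  This makes a splitting out of two complementary projections whose ranges are copies of the space.
\<close>

lemma projection_factorization:
  assumes iso: "linearly_homeomorphic s UNIV norm s (range Q) norm"
    and Q: "bop Q" and QQ: "\<And>x. Q (Q x) = Q x"
  obtains b b' where "bop b" and "bop b'" and "\<And>x. b' (b x) = x" and "\<And>x. b (b' x) = Q x"
proof -
  obtain J C where lin: "linear_bijection s UNIV s (range Q) J"
    and bd: "\<forall>x. norm (J x) \<le> C * norm x \<and> norm x \<le> C * norm (J x)"
    using iso unfolding linearly_homeomorphic_def by blast
  have bij: "bij_betw J UNIV (range Q)" and J_add: "J (x + y) = J x + J y"
    and J_scale: "J (s c x) = s c (J x)" for x y c
    using lin by (auto simp: linear_bijection_def)
  note bd = bd[rule_format, THEN conjunct1] bd[rule_format, THEN conjunct2]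
  define b' where "b' x = inv J (Q x)" for x
  have Jb': "J (b' x) = Q x" for x
    unfolding b'_def by (rule bij_betw_inv_into_right[OF bij]) simp
  have inj: "inj J"
    using bij by (simp add: bij_betw_def)
  have "Q (J x) = J x" for x
  proof -
    have "J x \<in> range Q"
      using bij by (auto simp: bij_betw_def)
    then show ?thesis
      using QQ by auto
  qed
  then have b'J: "b' (J x) = x" for x
    using injD[OF inj] Jb' by metis
  have J: "bop J"
    by (rule bopI[OF J_add J_scale bd(1)])
  obtain q where q: "\<And>x. norm (Q x) \<le> q * norm x"
    using Q by (metis bop_bound)
  have "norm (b' x) \<le> (\<bar>C\<bar> * q) * norm x" for x
  proof -
    have "norm (b' x) \<le> \<bar>C\<bar> * norm (Q x)"
      using bd(2)[of "b' x"] mult_right_mono[OF abs_ge_self[of C] norm_ge_zero[of "Q x"]]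
      unfolding Jb' by linarith
    also have "\<dots> \<le> \<bar>C\<bar> * (q * norm x)"
      using q by (intro mult_left_mono) auto
    finally show ?thesis
      by (simp add: mult_ac)
  qed
  moreover have "b' (x + y) = b' x + b' y" and "b' (s c x) = s c (b' x)" for x y c
    by (rule injD[OF inj], simp add: Jb' J_add J_scale bop_add[OF Q] bop_scale[OF Q])+
  ultimately have "bop b'"
    by (intro bopI)
  then show ?thesis
    using that J b'J Jb' by blast
qed

lemma compact_on_cball:
  assumes K: "bop K" and compact: "compact (closure (K ` cball 0 1))"
  obtains D where "compact D" and "K ` cball 0 r \<subseteq> D"
proof -
  define m where "m = \<bar>r\<bar> + 1"
  have m: "0 < m" "r \<le> m"
    by (auto simp: m_def)
  have "K ` cball 0 r \<subseteq> (\<lambda>z. m *\<^sub>R z) ` closure (K ` cball 0 1)"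
  proof
    fix w assume "w \<in> K ` cball 0 r"
    then obtain x where x: "norm x \<le> r" and w: "w = K x"
      by auto
    have "K (x /\<^sub>R m) \<in> closure (K ` cball 0 1)"
      using x m by (intro closure_subset[THEN subsetD] imageI) (simp add: divide_simps)
    moreover have "w = m *\<^sub>R K (x /\<^sub>R m)"
      using m linear_scale[OF bounded_linear.linear[OF bop_linear[OF K]]] by (simp add: w)
    ultimately show "w \<in> (\<lambda>z. m *\<^sub>R z) ` closure (K ` cball 0 1)"
      by blast
  qed
  then show ?thesis
    using that compact_scaling[OF compact] by blast
qed

end

context sum_decomposition
begin

text \<open>
  The case \<open>p = 1\<close> is reduced to small columns by composing the first embedding with the shear;
  this changes neither its range nor the projection onto it.
\<close>

lemma commutator_of_compact_restriction:
  assumes T: "bop T" and ab: "splitting a a' b b'"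
    and compact: "\<And>r. \<exists>D. compact D \<and> (\<lambda>x. T (a x)) ` cball 0 r \<subseteq> D"
    and approx: "p = 1 \<Longrightarrow> ell1_approximable s"
  shows "commutator s T"
proof -
  note A = splittingD[OF ab]
  have K: "bop (\<lambda>x. T (a x))"
    by (rule bop_comp[OF T A(1)])
  show ?thesis
  proof (cases "p = 1")
    case False
    obtain D where D: "compact D" "(\<lambda>x. T (a x)) ` cball 0 1 \<subseteq> D"
      using compact by blast
    show ?thesis
      by (rule commutator_of_inf_small_columns[OF T ab compact_columns_small[OF K D _ False]])
  next
    case True
    obtain D where D: "compact D" "(\<lambda>x. T (a x)) ` cball 0 C \<subseteq> D"
      using compact by blast
    obtain S where S: "bop S" and SS: "\<And>x. S (S x) = 0"
      and small: "\<And>\<epsilon> N. 0 < \<epsilon> \<Longrightarrow>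
        \<exists>j\<ge>N. \<forall>x. norm (T (a (ins j x - S (ins j x)))) \<le> \<epsilon> * norm x"
      using compact_columns_small_after_shear[OF approx[OF True] K D] by metis
    have "splitting (\<lambda>x. a (x - S x)) (\<lambda>x. a' x + S (a' x)) b b'"
      unfolding splitting_def
    proof (intro conjI allI)
      show "bop (\<lambda>x. a (x - S x))" "bop (\<lambda>x. a' x + S (a' x))"
        by (intro bop_comp[OF A(1)] bop_minus_op bop_plus bop_id S A(2) bop_comp[OF S A(2)])+
      show "a' (a (x - S x)) + S (a' (a (x - S x))) = x" for x
        by (simp add: A bop_diff[OF S] SS)
      show "a (a' x + S (a' x) - S (a' x + S (a' x))) + b (b' x) = x" for x
        by (simp add: A bop_add[OF S] SS)
    qed (simp_all add: A)
    then show ?thesis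
      by (rule commutator_of_inf_small_columns[OF T]) (rule small)
  qed
qed

end

theorem corollary3p4:
  fixes s :: "'k::{real_normed_field, euclidean_space} \<Rightarrow> 'a::banach \<Rightarrow> 'a"
    and p :: real and T P :: "'a \<Rightarrow> 'a"
  assumes "normed_scaling s"
    and "1 \<le> p \<or> p = 0"
    and "linearly_homeomorphic s (UNIV :: 'a set) norm
           (seq_scale s) (seq_sum p :: (nat \<Rightarrow> 'a) set) (seq_norm p)"
    and "p = 1 \<Longrightarrow>
           isometrically_isomorphic s (UNIV :: 'a set) norm L1_scale (UNIV :: 'k L1 set) norm \<or>
           isometrically_isomorphic s (UNIV :: 'a set) norm
             (seq_scale (*)) (seq_sum 1 :: (nat \<Rightarrow> 'k) set) (seq_norm 1)"
    and "bounded_operator s T"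
    and "bounded_projection s P"
    and "linearly_homeomorphic s (range P) norm s (UNIV :: 'a set) norm"
    and "linearly_homeomorphic s (UNIV :: 'a set) norm s (range (\<lambda>x. x - P x)) norm"
    and "compact_operator s (T \<circ> P) \<or> compact_operator s (P \<circ> T)"
  shows "commutator s T"
proof -
  interpret scaled_space s
    by unfold_locales (rule assms(1))
  note T = assms(5)
  have P: "bop P" and PP: "P (P x) = P x" for x
    using assms(6) by (auto simp: bounded_projection_def comp_def dest: fun_cong)
  obtain J C where J: "linear_bijection s UNIV (seq_scale s) (seq_sum p) J"
    and bd: "\<And>x. seq_norm p (J x) \<le> C * norm x" "\<And>x. norm x \<le> C * seq_norm p (J x)"
    using assms(3) by (auto simp: linearly_homeomorphic_def)
  interpret sum_decomposition s p J "max C 1"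
  proof unfold_locales
    fix x
    have "J x \<in> seq_sum p"
      using J by (auto simp: linear_bijection_def bij_betw_def)
    then show "norm x \<le> max C 1 * seq_norm p (J x)"
      using bd(2) by (meson max.cobounded1 mult_right_mono order_trans seq_norm_nonneg)
    show "seq_norm p (J x) \<le> max C 1 * norm x"
      using bd(1) by (meson max.cobounded1 mult_right_mono order_trans norm_ge_zero)
  qed (use assms(2) J in auto)
  have "linearly_homeomorphic s UNIV norm s (range P) norm"
    by (rule linearly_homeomorphic_sym[OF assms(7)])
      (auto simp: bop_add[OF P, symmetric] bop_scale[OF P, symmetric])
  then obtain a a' where a: "bop a" "bop a'" "\<And>x. a' (a x) = x" "\<And>x. a (a' x) = P x"
    using projection_factorization P PP by blast
  have I_P: "bop (\<lambda>x. x - P x)"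
    by (rule bop_minus_op[OF bop_id P])
  then obtain b b' where b: "bop b" "bop b'" "\<And>x. b' (b x) = x" "\<And>x. b (b' x) = x - P x"
    using projection_factorization[OF assms(8) I_P] by (auto simp: bop_diff[OF P] PP)
  have ab: "splitting a a' b b'"
    unfolding splitting_def by (simp add: a b)
  show ?thesis
    using assms(9)
  proof
    assume TP: "compact_operator s (T \<circ> P)"
    show ?thesis
    proof (rule commutator_of_compact_restriction[OF T ab])
      fix r
      obtain c where c0: "0 \<le> c" and c: "\<And>x. norm (a x) \<le> c * norm x"
        using a(1) by (metis bop_bound)
      obtain D where D: "compact D" "(T \<circ> P) ` cball 0 (c * r) \<subseteq> D"
        using TP compact_on_cball unfolding compact_operator_def by metis
      have "T (a x) \<in> D" if x: "norm x \<le> r" for x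
      proof -
        have "norm (a x) \<le> c * r"
          using x c0 by (intro order_trans[OF c] mult_left_mono)
        then have "(T \<circ> P) (a x) \<in> D"
          using D(2) by (auto simp del: comp_apply)
        then show ?thesis
          by (simp flip: a(4)) (simp add: a(3))
      qed
      then show "\<exists>D. compact D \<and> (\<lambda>x. T (a x)) ` cball 0 r \<subseteq> D"
        using D(1) by (intro exI[of _ D]) auto
    next
      assume "p = 1"
      then show "ell1_approximable s"
        using assms(4) ell1_approximable_isometric[OF _ ell1_approximable_L1]
          ell1_approximable_seq_sum by blast
    qed
  next
    assume PT: "compact_operator s (P \<circ> T)"
    define D where "D = a' ` closure ((P \<circ> T) ` cball 0 1)"
    have D: "compact D"
      unfolding D_def using PT
      by (intro compact_continuous_image linear_continuous_on bop_linear a)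
        (simp add: compact_operator_def)
    have "a' (T x) = a' ((P \<circ> T) x)" for x
      by (simp flip: a(4)) (simp add: a(3))
    then have TD: "(\<lambda>x. a' (T x)) ` cball 0 1 \<subseteq> D"
      unfolding D_def using closure_subset[of "(P \<circ> T) ` cball 0 1"] by auto
    show ?thesis
      by (rule commutator_of_inf_small_rows[OF T ab compact_rows_small[OF bop_comp[OF a(2) T] D TD]])
  qed
qed

end
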